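(* Let $L\in\mathcal L$ and let $K_1,\ldots,K_n$ be nonnegative matrices that define operators on $L$. If $\alpha_1,\ldots,\alpha_n$ are nonnegative numbers such that $s_n=\sum_{i=1}^n\alpha_i\ge1$, if $m,l\in\mathbb N$, and if $\beta_i=\frac{\alpha_i}{s_n}$ for all $i=1,\ldots,n$, then $$r\big(K_1^{(\alpha_1)}\circ\cdots\circ K_n^{(\alpha_n)}\big)\le r\big((K_1^m)^{(\alpha_1)}\circ\cdots\circ(K_n^m)^{(\alpha_n)}\big)^{\frac1m}$$ $$\le r\big((K_1^{ml})^{(\alpha_1)}\circ\cdots\circ(K_n^{ml})^{(\alpha_n)}\big)^{\frac1{ml}}\le r\big((K_1^{ml})^{(\beta_1)}\circ\cdots\circ(K_n^{ml})^{(\beta_n)}\big)^{\frac{s_n}{ml}}\le r(K_1)^{\alpha_1}\cdots r(K_n)^{\alpha_n}$$ and $$r\big(K_1^{(\alpha_1)}\circ\cdots\circ K_n^{(\alpha_n)}\big)\le r\big((K_1^m)^{(\alpha_1)}\circ\cdots\circ(K_n^m)^{(\alpha_n)}\big)^{\frac1m}$$ $$\le r\big((K_1^m)^{(\beta_1)}\circ\cdots\circ(K_n^m)^{(\beta_n)}\big)^{\frac{s_n}{m}}\le r\big((K_1^{ml})^{(\beta_1)}\circ\cdots\circ(K_n^{ml})^{(\beta_n)}\big)^{\frac{s_n}{ml}}\le r(K_1)^{\alpha_1}\cdots r(K_n)^{\alpha_n}.$$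
   Context: $R$ is $\{1,\ldots,N\}$ for some $N\in\mathbb N$ or $R=\mathbb N$. A Banach sequence space is a Banach space $L$ of complex sequences indexed by $R$ such that $x\in L$ and $|y|\le|x|$ imply $y\in L$ and $\|y\|_L\le\|x\|_L$. $\mathcal L$ is the collection of Banach sequence spaces $L$ such that $e_n=\chi_{\{n\}}\in L$ and $\|e_n\|_L=1$ for all $n\in R$. A matrix $K=[k(i,j)]_{i,j\in R}$ with entries $\ge0$ is called nonnegative; it defines an operator on $L$ if $Kx\in L$ for all $x\in L$, where $(Kx)_i=\sum_jk(i,j)x_j$ (it is then automatically bounded). $\circ$ is the entrywise (Hadamard) product and $K^{(t)}=[k(i,j)^t]$, $t\ge0$ (convention $0^0=1$); under the hypotheses the Hadamard products in question define operators on $L$. $K^m$ is the ordinary matrix power and $r$ is the spectral radius on $L$. *)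

theory Defs
  imports "HOL-Analysis.Analysis"
begin

text \<open>
  Sequences indexed by \<open>R\<close> are functions on \<open>nat\<close> that vanish outside \<open>R\<close>, and the natural
  numbers start at 1.  Since every \<open>x \<in> L\<close> vanishes outside \<open>R\<close>, so does every \<open>y\<close> in the
  assumption \<open>solid\<close>.
\<close>

locale banach_sequence_space =
  fixes R :: "nat set"
    and L :: "(nat \<Rightarrow> complex) set"
    and nrm :: "(nat \<Rightarrow> complex) \<Rightarrow> real"
  assumes index_set: "(\<exists>N\<ge>1. R = {1..N}) \<or> R = {1..}"
    and supported: "\<And>x i. x \<in> L \<Longrightarrow> i \<notin> R \<Longrightarrow> x i = 0"
    and zero_mem: "(\<lambda>i. 0) \<in> L"
    and add_mem: "\<And>x y. x \<in> L \<Longrightarrow> y \<in> L \<Longrightarrow> (\<lambda>i. x i + y i) \<in> L"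
    and scale_mem: "\<And>c x. x \<in> L \<Longrightarrow> (\<lambda>i. c * x i) \<in> L"
    and nrm_nonneg: "\<And>x. x \<in> L \<Longrightarrow> 0 \<le> nrm x"
    and nrm_eq_0D: "\<And>x. x \<in> L \<Longrightarrow> nrm x = 0 \<Longrightarrow> x = (\<lambda>i. 0)"
    and nrm_scale: "\<And>c x. x \<in> L \<Longrightarrow> nrm (\<lambda>i. c * x i) = cmod c * nrm x"
    and nrm_triangle: "\<And>x y. x \<in> L \<Longrightarrow> y \<in> L \<Longrightarrow> nrm (\<lambda>i. x i + y i) \<le> nrm x + nrm y"
    and complete: "\<And>X. (\<And>p. X p \<in> L) \<Longrightarrow>
      (\<And>e. e > 0 \<Longrightarrow> \<exists>M. \<forall>p\<ge>M. \<forall>q\<ge>M. nrm (\<lambda>i. X p i - X q i) < e) \<Longrightarrow>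
      \<exists>x\<in>L. (\<lambda>p. nrm (\<lambda>i. X p i - x i)) \<longlonglongrightarrow> 0"
    and solid: "\<And>x y. x \<in> L \<Longrightarrow> (\<And>i. cmod (y i) \<le> cmod (x i)) \<Longrightarrow> y \<in> L \<and> nrm y \<le> nrm x"

definition unit_seq :: "nat \<Rightarrow> nat \<Rightarrow> complex" where
  "unit_seq p = (\<lambda>i. if i = p then 1 else 0)"

text \<open>The class \<open>\<L>\<close>.\<close>

locale normalized_banach_sequence_space = banach_sequence_space +
  assumes unit_seq_mem: "\<And>p. p \<in> R \<Longrightarrow> unit_seq p \<in> L"
    and nrm_unit_seq: "\<And>p. p \<in> R \<Longrightarrow> nrm (unit_seq p) = 1"


text \<open>
  Bounded operators on \<open>L\<close> are functions whose values outside \<open>L\<close> are irrelevant; invertibility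
  is invertibility in the algebra of bounded linear operators on \<open>L\<close>.
\<close>

definition bounded_op ::
  "(nat \<Rightarrow> complex) set \<Rightarrow> ((nat \<Rightarrow> complex) \<Rightarrow> real) \<Rightarrow> ((nat \<Rightarrow> complex) \<Rightarrow> nat \<Rightarrow> complex) \<Rightarrow> bool"
where
  "bounded_op L nrm T \<longleftrightarrow>
     (\<forall>x\<in>L. T x \<in> L) \<and>
     (\<forall>x\<in>L. \<forall>y\<in>L. T (\<lambda>i. x i + y i) = (\<lambda>i. T x i + T y i)) \<and>
     (\<forall>c. \<forall>x\<in>L. T (\<lambda>i. c * x i) = (\<lambda>i. c * T x i)) \<and>
     (\<exists>B. \<forall>x\<in>L. nrm (T x) \<le> B * nrm x)"

definition invertible_op ::
  "(nat \<Rightarrow> complex) set \<Rightarrow> ((nat \<Rightarrow> complex) \<Rightarrow> real) \<Rightarrow> ((nat \<Rightarrow> complex) \<Rightarrow> nat \<Rightarrow> complex) \<Rightarrow> bool"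
where
  "invertible_op L nrm T \<longleftrightarrow>
     bounded_op L nrm T \<and> (\<exists>S. bounded_op L nrm S \<and> (\<forall>x\<in>L. S (T x) = x \<and> T (S x) = x))"

definition op_spectrum ::
  "(nat \<Rightarrow> complex) set \<Rightarrow> ((nat \<Rightarrow> complex) \<Rightarrow> real) \<Rightarrow> ((nat \<Rightarrow> complex) \<Rightarrow> nat \<Rightarrow> complex) \<Rightarrow> complex set"
where
  "op_spectrum L nrm T = {z. \<not> invertible_op L nrm (\<lambda>x i. z * x i - T x i)}"

definition op_spectral_radius ::
  "(nat \<Rightarrow> complex) set \<Rightarrow> ((nat \<Rightarrow> complex) \<Rightarrow> real) \<Rightarrow> ((nat \<Rightarrow> complex) \<Rightarrow> nat \<Rightarrow> complex) \<Rightarrow> real"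
where
  "op_spectral_radius L nrm T = Sup (cmod ` op_spectrum L nrm T)"


text \<open>Only the entries of a matrix with both indices in \<open>R\<close> are meaningful.\<close>

definition nonneg_matrix :: "nat set \<Rightarrow> (nat \<Rightarrow> nat \<Rightarrow> real) \<Rightarrow> bool" where
  "nonneg_matrix R k \<longleftrightarrow> (\<forall>i\<in>R. \<forall>j\<in>R. 0 \<le> k i j)"

definition mat_op ::
  "nat set \<Rightarrow> (nat \<Rightarrow> nat \<Rightarrow> real) \<Rightarrow> (nat \<Rightarrow> complex) \<Rightarrow> nat \<Rightarrow> complex"
where
  "mat_op R k x = (\<lambda>i. if i \<in> R then \<Sum>\<^sub>\<infinity>j\<in>R. of_real (k i j) * x j else 0)"

text \<open>
  For a nonnegative \<open>k\<close> the series defining \<open>k x\<close> converge for all \<open>x \<in> L\<close> iff they converge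
  absolutely for all \<open>x \<in> L\<close>, as \<open>L\<close> contains \<open>\<bar>x\<bar>\<close> with \<open>x\<close>; so unordered summability is no
  restriction.  It has to be required because \<open>infsum\<close> is 0 on non-summable families.
\<close>

definition defines_operator ::
  "nat set \<Rightarrow> (nat \<Rightarrow> complex) set \<Rightarrow> (nat \<Rightarrow> nat \<Rightarrow> real) \<Rightarrow> bool"
where
  "defines_operator R L k \<longleftrightarrow>
     (\<forall>x\<in>L. (\<forall>i\<in>R. (\<lambda>j. of_real (k i j) * x j) summable_on R) \<and> mat_op R k x \<in> L)"

definition spectral_radius ::
  "nat set \<Rightarrow> (nat \<Rightarrow> complex) set \<Rightarrow> ((nat \<Rightarrow> complex) \<Rightarrow> real) \<Rightarrow> (nat \<Rightarrow> nat \<Rightarrow> real) \<Rightarrow> real"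
where
  "spectral_radius R L nrm k = op_spectral_radius L nrm (mat_op R k)"

definition mat_mult ::
  "nat set \<Rightarrow> (nat \<Rightarrow> nat \<Rightarrow> real) \<Rightarrow> (nat \<Rightarrow> nat \<Rightarrow> real) \<Rightarrow> nat \<Rightarrow> nat \<Rightarrow> real"
where
  "mat_mult R a b = (\<lambda>i j. \<Sum>\<^sub>\<infinity>p\<in>R. a i p * b p j)"

primrec mat_power :: "nat set \<Rightarrow> (nat \<Rightarrow> nat \<Rightarrow> real) \<Rightarrow> nat \<Rightarrow> nat \<Rightarrow> nat \<Rightarrow> real" where
  "mat_power R k 0 = (\<lambda>i j. if i = j then 1 else 0)"
| "mat_power R k (Suc m) = mat_mult R k (mat_power R k m)"

text \<open>Real powers of nonnegative numbers with \<open>0\<^sup>0 = 1\<close>, whereas \<open>0 powr 0 = 0\<close>.\<close>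

definition rpow :: "real \<Rightarrow> real \<Rightarrow> real" where
  "rpow x t = (if t = 0 then 1 else x powr t)"

text \<open>The matrix \<open>K\<^sub>1\<^bsup>(\<alpha>\<^sub>1)\<^esup> \<circ> \<dots> \<circ> K\<^sub>n\<^bsup>(\<alpha>\<^sub>n)\<^esup>\<close>.\<close>

definition hadamard_prod ::
  "nat \<Rightarrow> (nat \<Rightarrow> nat \<Rightarrow> nat \<Rightarrow> real) \<Rightarrow> (nat \<Rightarrow> real) \<Rightarrow> nat \<Rightarrow> nat \<Rightarrow> real"
where
  "hadamard_prod n K \<alpha> = (\<lambda>i j. \<Prod>p\<in>{1..n}. rpow (K p i j) (\<alpha> p))"

end

theory Submission
  imports Defs
begin

text \<open>
  All matrices act on the solid space \<open>L\<close>, so an entrywise inequality \<open>0 \<le> a \<le> b\<close> gives \<open>\<parallel>a x\<parallel> \<le> \<parallel>b\<parallel> \<parallel>x\<parallel>\<close>.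
  Write \<open>H(K, \<alpha>)\<close> for the matrix \<open>K\<^sub>1\<^bsup>(\<alpha>\<^sub>1)\<^esup> \<circ> \<dots> \<circ> K\<^sub>n\<^bsup>(\<alpha>\<^sub>n)\<^esup>\<close>. If \<open>\<Sum>\<alpha> \<ge> 1\<close>, two facts hold, both consequences
  of the weighted AM-GM inequality after normalization (\<open>prod_rpow_le_weighted_sum\<close>):

  \<^item> \<open>H(K, \<alpha>)\<^sup>m \<le> H(K\<^sup>m, \<alpha>)\<close> entrywise, by Hoelder's inequality for the sums that define the
    matrix product (\<open>mat_power_hadamard_prod_le\<close>);
  \<^item> \<open>\<parallel>H(K, \<alpha>)\<parallel> \<le> \<Prod> \<parallel>K\<^sub>q\<parallel>\<^bsup>\<alpha>\<^sub>q\<^esup>\<close>, as no entry exceeds the norm (\<open>hadamard_prod_bounded\<close>).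

  By Gelfand's formula the first fact yields \<open>r(H(K, \<alpha>)) \<le> r(H(K\<^sup>m, \<alpha>))\<^sup>1\<^sup>/\<^sup>m\<close>, and both together
  yield \<open>r(H(K, \<alpha>)) \<le> \<Prod> r(K\<^sub>q)\<^bsup>\<alpha>\<^sub>q\<^esup>\<close>. With a single factor \<open>Y = H(K, \<beta>)\<close> and exponent \<open>s\<close> the latter
  reads \<open>r(H(K, \<alpha>)) \<le> r(H(K, \<beta>))\<^sup>s\<close>. Applied to \<open>K\<close>, \<open>K\<^sup>m\<close> and \<open>K\<^sup>m\<^sup>l\<close>, these three inequalities give
  both chains.

  Gelfand's formula is proved for nonnegative matrices in the form that \<open>r(a)\<close> is the infimum of
  the \<open>\<mu> > 0\<close> with \<open>\<parallel>a\<^sup>k\<parallel> = O(\<mu>\<^sup>k)\<close>. One half is the Neumann series (\<open>growth_bound_imp_invertible\<close>). For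
  the other half, order replaces complex analysis: if \<open>t - a\<close> is invertible for all real
  \<open>t \<ge> \<mu>\<close>, then its inverse is positive for large \<open>t\<close>, positivity propagates down to \<open>t = \<mu>\<close>, and a
  positive inverse of \<open>\<mu> - a\<close> bounds all \<open>a\<^sup>k / \<mu>\<^sup>k\<close> (\<open>invertible_imp_growth_bound\<close>). The
  second half also shows that the spectrum is not empty (\<open>op_spectrum_nonempty\<close>).
\<close>

section \<open>Banach sequence spaces\<close>

definition abs_seq :: "(nat \<Rightarrow> complex) \<Rightarrow> nat \<Rightarrow> complex" where
  "abs_seq x = (\<lambda>i. of_real (cmod (x i)))"

lemma cmod_mono_nonneg: "0 \<le> x \<Longrightarrow> x \<le> y \<Longrightarrow> cmod x \<le> cmod y" for x y :: complex
  by (simp add: less_eq_complex_def cmod_def)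

context banach_sequence_space
begin

lemma minus_mem: "x \<in> L \<Longrightarrow> y \<in> L \<Longrightarrow> (\<lambda>i. x i - y i) \<in> L"
  using add_mem[of x "\<lambda>i. (-1) * y i"] scale_mem[of y "-1"] by simp

lemma nrm_zero: "nrm (\<lambda>i. 0) = 0"
  using nrm_scale[OF zero_mem, of 0] by simp

lemma nrm_minus_commute: "x \<in> L \<Longrightarrow> y \<in> L \<Longrightarrow> nrm (\<lambda>i. x i - y i) = nrm (\<lambda>i. y i - x i)"
  using nrm_scale[OF minus_mem, of x y "-1"] by simp

lemma nrm_triangle_minus: "x \<in> L \<Longrightarrow> y \<in> L \<Longrightarrow> nrm (\<lambda>i. x i - y i) \<le> nrm x + nrm y"
  using nrm_triangle[of x "\<lambda>i. (-1) * y i"] scale_mem[of y "-1"] nrm_scale[of y "-1"] by simp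

lemma nrm_mono: "x \<in> L \<Longrightarrow> (\<And>i. cmod (y i) \<le> cmod (x i)) \<Longrightarrow> nrm y \<le> nrm x"
  using solid by blast

lemma abs_seq_mem: "x \<in> L \<Longrightarrow> abs_seq x \<in> L"
  using solid[of x "abs_seq x"] by (simp add: abs_seq_def)

lemma nrm_abs_seq: "x \<in> L \<Longrightarrow> nrm (abs_seq x) = nrm x"
  using solid[of x "abs_seq x"] solid[of "abs_seq x" x] by (simp add: abs_seq_def)

lemma sum_mem: "(\<And>k. k \<in> A \<Longrightarrow> f k \<in> L) \<Longrightarrow> (\<lambda>i. \<Sum>k\<in>A. f k i) \<in> L"
  by (induction A rule: infinite_finite_induct) (auto simp: zero_mem intro!: add_mem)

lemma nrm_sum: "(\<And>k. k \<in> A \<Longrightarrow> f k \<in> L) \<Longrightarrow> nrm (\<lambda>i. \<Sum>k\<in>A. f k i) \<le> (\<Sum>k\<in>A. nrm (f k))"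
proof (induction A rule: infinite_finite_induct)
  case (insert k A)
  then show ?case
    using nrm_triangle[of "f k" "\<lambda>i. \<Sum>k\<in>A. f k i"] by (fastforce simp: sum_mem)
qed (auto simp: nrm_zero)

text \<open>
  Both uses of completeness go through this criterion: the boundedness of operators given by
  matrices, and the Neumann series.
\<close>

lemma absolutely_convergent_series:
  assumes f: "\<And>k. f k \<in> L" and le: "\<And>k. nrm (f k) \<le> g k" and g: "summable g"
  obtains y where "y \<in> L" "(\<lambda>N. nrm (\<lambda>i. (\<Sum>k<N. f k i) - y i)) \<longlonglongrightarrow> 0"
proof -
  define X where "X N = (\<lambda>i. \<Sum>k<N. f k i)" for N :: nat
  have XL: "X N \<in> L" for N
    unfolding X_def using f by (intro sum_mem)
  have half: "nrm (\<lambda>i. X q i - X p i) < e"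
    if M: "\<And>m n. m \<ge> M \<Longrightarrow> norm (sum g {m..<n}) < e" and pq: "M \<le> p" "p \<le> q" for e M p q
  proof -
    have "nrm (\<lambda>i. X q i - X p i) = nrm (\<lambda>i. \<Sum>k\<in>{p..<q}. f k i)"
      using pq by (auto simp: X_def lessThan_atLeast0 sum_diff_nat_ivl)
    also have "\<dots> \<le> (\<Sum>k\<in>{p..<q}. nrm (f k))"
      using f by (intro nrm_sum)
    also have "\<dots> \<le> (\<Sum>k\<in>{p..<q}. g k)"
      using le by (intro sum_mono)
    also have "\<dots> < e"
      using M[OF pq(1), of q] by (auto simp: abs_less_iff)
    finally show ?thesis .
  qed
  have "\<exists>y\<in>L. (\<lambda>p. nrm (\<lambda>i. X p i - y i)) \<longlonglongrightarrow> 0"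
  proof (rule complete[OF XL])
    fix e :: real assume "e > 0"
    then obtain M where M: "\<And>m n. m \<ge> M \<Longrightarrow> norm (sum g {m..<n}) < e"
      using g unfolding summable_Cauchy by blast
    have "nrm (\<lambda>i. X p i - X q i) < e" if "p \<ge> M" "q \<ge> M" for p q
    proof (cases "p \<le> q")
      case True
      then show ?thesis
        using half[where p = p and q = q, OF M] that nrm_minus_commute[OF XL XL, of p q] by simp
    next
      case False
      then show ?thesis using half[where p = q and q = p, OF M] that by simp
    qed
    then show "\<exists>M. \<forall>p\<ge>M. \<forall>q\<ge>M. nrm (\<lambda>i. X p i - X q i) < e" by blast
  qed
  then show thesis using that unfolding X_def by blast
qed

end

context normalized_banach_sequence_space
begin

text \<open>
  Solidity applied to \<open>\<bar>x\<^sub>i\<bar> e\<^sub>i \<le> \<bar>x\<bar>\<close>, with \<open>\<parallel>e\<^sub>i\<parallel> = 1\<close>. It makes convergence in \<open>L\<close> imply convergence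
  of all coordinates.
\<close>

lemma coordinate_le_nrm:
  assumes "x \<in> L" shows "cmod (x i) \<le> nrm x"
proof (cases "i \<in> R")
  case True
  have "nrm (\<lambda>j. x i * unit_seq i j) \<le> nrm x"
    by (rule nrm_mono[OF assms]) (auto simp: unit_seq_def)
  then show ?thesis
    using True nrm_scale[OF unit_seq_mem, of i "x i"] by (simp add: nrm_unit_seq)
next
  case False
  then show ?thesis using supported[OF assms] nrm_nonneg[OF assms] by simp
qed

lemma nrm_tendsto_imp_coordinate_tendsto:
  assumes X: "\<And>p. X p \<in> L" and y: "y \<in> L" and lim: "(\<lambda>p. nrm (\<lambda>i. X p i - y i)) \<longlonglongrightarrow> 0"
  shows "(\<lambda>p. X p i) \<longlonglongrightarrow> y i"
proof -
  have "(\<lambda>p. X p i - y i) \<longlonglongrightarrow> 0"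
    by (rule Lim_null_comparison[OF _ lim])
       (use coordinate_le_nrm[OF minus_mem[OF X y]] in auto)
  then show ?thesis by (simp add: LIM_zero_iff)
qed

section \<open>Nonnegative matrices as bounded operators\<close>

definition operator_matrix :: "(nat \<Rightarrow> nat \<Rightarrow> real) \<Rightarrow> bool" where
  "operator_matrix a \<longleftrightarrow> nonneg_matrix R a \<and> defines_operator R L a"

lemma operator_matrix_nonneg: "operator_matrix a \<Longrightarrow> i \<in> R \<Longrightarrow> j \<in> R \<Longrightarrow> 0 \<le> a i j"
  by (auto simp: operator_matrix_def nonneg_matrix_def)

lemma mat_op_mem: "operator_matrix a \<Longrightarrow> x \<in> L \<Longrightarrow> mat_op R a x \<in> L"
  by (auto simp: operator_matrix_def defines_operator_def)

lemma row_summable: "operator_matrix a \<Longrightarrow> x \<in> L \<Longrightarrow> i \<in> R \<Longrightarrow> (\<lambda>j. of_real (a i j) * x j) summable_on R"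
  by (auto simp: operator_matrix_def defines_operator_def)

lemma mat_op_cong: "(\<And>i j. i \<in> R \<Longrightarrow> j \<in> R \<Longrightarrow> a i j = b i j) \<Longrightarrow> mat_op R a = mat_op R b"
  by (auto simp: mat_op_def fun_eq_iff intro!: infsum_cong)

lemma mat_op_add:
  assumes "operator_matrix a" "x \<in> L" "y \<in> L"
  shows "mat_op R a (\<lambda>i. x i + y i) = (\<lambda>i. mat_op R a x i + mat_op R a y i)"
  using row_summable[OF assms(1)] assms
  by (auto simp: mat_op_def fun_eq_iff distrib_left intro!: infsum_add)

lemma mat_op_scale: "mat_op R a (\<lambda>i. c * x i) = (\<lambda>i. c * mat_op R a x i)"
proof
  fix i
  have "(\<Sum>\<^sub>\<infinity>j\<in>R. of_real (a i j) * (c * x j)) = (\<Sum>\<^sub>\<infinity>j\<in>R. c * (of_real (a i j) * x j))"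
    by (simp add: algebra_simps)
  then show "mat_op R a (\<lambda>i. c * x i) i = c * mat_op R a x i"
    by (simp add: mat_op_def infsum_cmult_right')
qed

lemma mat_op_diff:
  assumes "operator_matrix a" "x \<in> L" "y \<in> L"
  shows "mat_op R a (\<lambda>i. x i - y i) = (\<lambda>i. mat_op R a x i - mat_op R a y i)"
  using mat_op_add[OF assms(1,2) scale_mem[OF assms(3), of "-1"]] mat_op_scale[of a "-1" y] by simp

lemma mat_op_cnj: "mat_op R a (\<lambda>i. cnj (x i)) = (\<lambda>i. cnj (mat_op R a x i))"
proof
  fix i
  have "(\<Sum>\<^sub>\<infinity>j\<in>R. of_real (a i j) * cnj (x j)) = (\<Sum>\<^sub>\<infinity>j\<in>R. cnj (of_real (a i j) * x j))"
    by simp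
  then show "mat_op R a (\<lambda>i. cnj (x i)) i = cnj (mat_op R a x i)"
    unfolding mat_op_def infsum_cnj by simp
qed

lemma mat_op_mono:
  assumes "operator_matrix a" "x \<in> L" "y \<in> L" "\<And>i. x i \<le> y i"
  shows "mat_op R a x i \<le> mat_op R a y i"
  using row_summable[OF assms(1)] assms operator_matrix_nonneg[OF assms(1)]
  by (auto simp: mat_op_def intro!: infsum_mono_complex mult_left_mono)
     (simp add: less_eq_complex_def)

lemma mat_op_nonneg:
  assumes "operator_matrix a" "x \<in> L" "\<And>i. 0 \<le> x i"
  shows "0 \<le> mat_op R a x i"
  using mat_op_mono[OF assms(1) zero_mem assms(2), of i] assms(3) by (simp add: mat_op_def split: if_splits)

text \<open>
  If a nonnegative matrix \<open>a\<close> is at most \<open>\<Sum>\<^sub>q w\<^sub>q b\<^sub>q\<close> entrywise, then \<open>\<bar>a x\<bar> \<le> \<Sum>\<^sub>q w\<^sub>q b\<^sub>q \<bar>x\<bar>\<close>. Solidity of \<open>L\<close> turns this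
  into the next lemma, which gives comparison of norms, and with the AM-GM inequality also
  the norm bound for Hadamard products.
\<close>

lemma dominated_rows:
  assumes I: "finite I" and b: "\<And>q. q \<in> I \<Longrightarrow> operator_matrix (b q)" and w: "\<And>q. q \<in> I \<Longrightarrow> 0 \<le> w q"
    and a0: "\<And>i j. i \<in> R \<Longrightarrow> j \<in> R \<Longrightarrow> 0 \<le> a i j"
    and ab: "\<And>i j. i \<in> R \<Longrightarrow> j \<in> R \<Longrightarrow> a i j \<le> (\<Sum>q\<in>I. w q * b q i j)"
    and x: "x \<in> L"
  shows "i \<in> R \<Longrightarrow> (\<lambda>j. of_real (a i j) * x j) summable_on R"
    and "cmod (mat_op R a x i) \<le> cmod (\<Sum>q\<in>I. of_real (w q) * mat_op R (b q) (abs_seq x) i)"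
proof -
  have *: "(\<lambda>j. cmod (of_real (a i j) * x j)) summable_on R \<and>
        cmod (mat_op R a x i) \<le> cmod (\<Sum>q\<in>I. of_real (w q) * mat_op R (b q) (abs_seq x) i)"
    if i: "i \<in> R"
  proof -
    define h where "h q j = w q * (b q i j * cmod (x j))" for q j
    have hq: "((\<lambda>j. complex_of_real (h q j)) has_sum of_real (w q) * mat_op R (b q) (abs_seq x) i) R"
      if q: "q \<in> I" for q
    proof -
      have "((\<lambda>j. of_real (b q i j) * abs_seq x j) has_sum mat_op R (b q) (abs_seq x) i) R"
        using row_summable[OF b[OF q] abs_seq_mem[OF x] i] i by (simp add: mat_op_def)
      from has_sum_cmult_right[OF this, of "of_real (w q)"] show ?thesis
        by (simp add: h_def abs_seq_def)
    qed
    have h: "((\<lambda>j. complex_of_real (\<Sum>q\<in>I. h q j)) has_sum (\<Sum>q\<in>I. of_real (w q) * mat_op R (b q) (abs_seq x) i)) R"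
      using I hq unfolding of_real_sum
    proof (induction I)
      case (insert q I)
      then show ?case by (auto intro!: has_sum_add)
    qed simp
    define S where "S = (\<Sum>\<^sub>\<infinity>j\<in>R. (\<Sum>q\<in>I. h q j))"
    have hs: "(\<lambda>j. \<Sum>q\<in>I. h q j) summable_on R"
      using summable_on_Re[OF has_sum_imp_summable[OF h]] by simp
    then have "((\<lambda>j. \<Sum>q\<in>I. h q j) has_sum S) R" by (simp add: S_def)
    then have S: "complex_of_real S = (\<Sum>q\<in>I. of_real (w q) * mat_op R (b q) (abs_seq x) i)"
      by (intro has_sum_unique[OF has_sum_of_real h])
    have le: "cmod (of_real (a i j) * x j) \<le> (\<Sum>q\<in>I. h q j)" if "j \<in> R" for j
      using mult_right_mono[OF ab[OF i that] norm_ge_zero[of "x j"]] a0[OF i that]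
      by (simp add: h_def norm_mult sum_distrib_right mult.assoc)
    have sm: "(\<lambda>j. cmod (of_real (a i j) * x j)) summable_on R"
      by (rule Infinite_Sum.abs_summable_on_comparison_test'[OF hs le])
    have "cmod (mat_op R a x i) \<le> (\<Sum>\<^sub>\<infinity>j\<in>R. cmod (of_real (a i j) * x j))"
      using norm_infsum_bound[OF sm] i by (simp add: mat_op_def)
    also have "\<dots> \<le> S"
      unfolding S_def using le by (intro infsum_mono sm hs)
    also have "\<dots> \<le> cmod (of_real S)" by simp
    finally show ?thesis using sm unfolding S by blast
  qed
  show "(\<lambda>j. of_real (a i j) * x j) summable_on R" if "i \<in> R"
    by (rule Infinite_Sum.abs_summable_summable) (use * that in blast)
  show "cmod (mat_op R a x i) \<le> cmod (\<Sum>q\<in>I. of_real (w q) * mat_op R (b q) (abs_seq x) i)"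
    using * by (cases "i \<in> R") (auto simp: mat_op_def)
qed

lemma operator_matrix_dominated:
  assumes I: "finite I" and b: "\<And>q. q \<in> I \<Longrightarrow> operator_matrix (b q)" and w: "\<And>q. q \<in> I \<Longrightarrow> 0 \<le> w q"
    and a0: "\<And>i j. i \<in> R \<Longrightarrow> j \<in> R \<Longrightarrow> 0 \<le> a i j"
    and ab: "\<And>i j. i \<in> R \<Longrightarrow> j \<in> R \<Longrightarrow> a i j \<le> (\<Sum>q\<in>I. w q * b q i j)"
  shows "operator_matrix a"
    and "\<lbrakk>\<And>q x. q \<in> I \<Longrightarrow> x \<in> L \<Longrightarrow> nrm (mat_op R (b q) x) \<le> c q * nrm x; x \<in> L\<rbrakk>
      \<Longrightarrow> nrm (mat_op R a x) \<le> (\<Sum>q\<in>I. w q * c q) * nrm x"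
proof -
  have mem: "(\<lambda>i. of_real (w q) * mat_op R (b q) (abs_seq x) i) \<in> L" if "q \<in> I" "x \<in> L" for q x
    using that b by (intro scale_mem mat_op_mem abs_seq_mem) auto
  have sm: "(\<lambda>i. \<Sum>q\<in>I. of_real (w q) * mat_op R (b q) (abs_seq x) i) \<in> L" if "x \<in> L" for x
    using mem that by (intro sum_mem) auto
  have dom: "mat_op R a x \<in> L \<and> nrm (mat_op R a x) \<le> nrm (\<lambda>i. \<Sum>q\<in>I. of_real (w q) * mat_op R (b q) (abs_seq x) i)"
    if "x \<in> L" for x
    using dominated_rows(2)[of I b w a x, OF I b w a0 ab that] by (intro solid[OF sm[OF that]]) auto
  show "operator_matrix a"
    unfolding operator_matrix_def nonneg_matrix_def defines_operator_def
    using a0 dom dominated_rows(1)[of I b w a, OF I b w a0 ab] by auto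
  show "nrm (mat_op R a x) \<le> (\<Sum>q\<in>I. w q * c q) * nrm x"
    if c: "\<And>q x. q \<in> I \<Longrightarrow> x \<in> L \<Longrightarrow> nrm (mat_op R (b q) x) \<le> c q * nrm x" and x: "x \<in> L"
  proof -
    have "nrm (mat_op R a x) \<le> nrm (\<lambda>i. \<Sum>q\<in>I. of_real (w q) * mat_op R (b q) (abs_seq x) i)"
      using dom x by blast
    also have "\<dots> \<le> (\<Sum>q\<in>I. nrm (\<lambda>i. of_real (w q) * mat_op R (b q) (abs_seq x) i))"
      using mem x by (intro nrm_sum) auto
    also have "\<dots> \<le> (\<Sum>q\<in>I. w q * (c q * nrm x))"
    proof (rule sum_mono)
      fix q assume q: "q \<in> I"
      have "nrm (\<lambda>i. of_real (w q) * mat_op R (b q) (abs_seq x) i) = w q * nrm (mat_op R (b q) (abs_seq x))"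
        using w[OF q] by (simp add: nrm_scale mat_op_mem b q abs_seq_mem x)
      also have "\<dots> \<le> w q * (c q * nrm x)"
        using c[OF q abs_seq_mem[OF x]] w[OF q] by (intro mult_left_mono) (auto simp: nrm_abs_seq x)
      finally show "nrm (\<lambda>i. of_real (w q) * mat_op R (b q) (abs_seq x) i) \<le> w q * (c q * nrm x)" .
    qed
    finally show ?thesis by (simp add: sum_distrib_right mult.assoc)
  qed
qed

lemma operator_matrix_mono:
  assumes "operator_matrix b" and "\<And>i j. i \<in> R \<Longrightarrow> j \<in> R \<Longrightarrow> 0 \<le> a i j"
    and "\<And>i j. i \<in> R \<Longrightarrow> j \<in> R \<Longrightarrow> a i j \<le> b i j"
  shows "operator_matrix a"
    and "\<lbrakk>\<And>x. x \<in> L \<Longrightarrow> nrm (mat_op R b x) \<le> c * nrm x; x \<in> L\<rbrakk> \<Longrightarrow> nrm (mat_op R a x) \<le> c * nrm x"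
proof -
  note dom = operator_matrix_dominated[of "{()}" "\<lambda>_. b" "\<lambda>_. 1" a]
  show "operator_matrix a" using dom(1) assms by auto
  show "nrm (mat_op R a x) \<le> c * nrm x"
    if "\<And>x. x \<in> L \<Longrightarrow> nrm (mat_op R b x) \<le> c * nrm x" "x \<in> L"
    using dom(2)[where c = "\<lambda>_. c"] assms that by auto
qed

lemma cmod_mat_op_le:
  assumes "operator_matrix a" "x \<in> L"
  shows "cmod (mat_op R a x i) \<le> cmod (mat_op R a (abs_seq x) i)"
  using dominated_rows(2)[of "{()}" "\<lambda>_. a" "\<lambda>_. 1" a x i] assms operator_matrix_nonneg[OF assms(1)] by auto

text \<open>
  A positive operator on a Banach lattice is bounded. Otherwise there are \<open>f\<^sub>p \<ge> 0\<close> with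
  \<open>\<parallel>f\<^sub>p\<parallel> = 2\<^sup>-\<^sup>p\<close> and \<open>\<parallel>a f\<^sub>p\<parallel> \<ge> p\<close>; their sum \<open>y\<close> exists in \<open>L\<close> and dominates every \<open>f\<^sub>p\<close>, hence
  \<open>\<parallel>a y\<parallel> \<ge> p\<close> for all \<open>p\<close>.
\<close>

lemma mat_op_bounded:
  assumes a: "operator_matrix a"
  obtains B where "B > 0" "\<And>x. x \<in> L \<Longrightarrow> nrm (mat_op R a x) \<le> B * nrm x"
proof -
  have "\<exists>B. \<forall>x\<in>L. nrm (mat_op R a x) \<le> B * nrm x"
  proof (rule ccontr)
    assume "\<not> ?thesis"
    then have "\<forall>p::nat. \<exists>x. x \<in> L \<and> nrm (mat_op R a x) > real p * 2 ^ p * nrm x"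
      by (force simp: not_le)
    then obtain x where xL: "\<And>p. x p \<in> L"
      and x: "\<And>p::nat. nrm (mat_op R a (x p)) > real p * 2 ^ p * nrm (x p)"
      by metis
    have x0: "nrm (x p) > 0" for p
    proof (rule ccontr)
      assume "\<not> nrm (x p) > 0"
      then have "x p = (\<lambda>i. 0)" using nrm_eq_0D[OF xL] nrm_nonneg[OF xL, of p] by simp
      then have "mat_op R a (x p) = (\<lambda>i. 0)" by (auto simp: mat_op_def)
      then show False using x[of p] \<open>x p = (\<lambda>i. 0)\<close> by (simp add: nrm_zero)
    qed
    define f where "f p = (\<lambda>i. of_real (1 / (2 ^ p * nrm (x p))) * abs_seq (x p) i)" for p
    have fL: "f p \<in> L" for p
      unfolding f_def by (intro scale_mem abs_seq_mem xL)
    have f0: "0 \<le> f p i" for p i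
      using x0[of p] by (simp add: f_def abs_seq_def less_eq_complex_def)
    have nf: "nrm (f p) = (1/2) ^ p" for p
      unfolding f_def nrm_scale[OF abs_seq_mem[OF xL]] using x0[of p]
      by (simp add: nrm_abs_seq xL norm_mult norm_divide norm_power power_divide)
    obtain y where y: "y \<in> L" and lim: "(\<lambda>N. nrm (\<lambda>i. (\<Sum>k<N. f k i) - y i)) \<longlonglongrightarrow> 0"
      using absolutely_convergent_series[of f "\<lambda>p. (1/2) ^ p"] fL nf by (auto simp: summable_geometric)
    have conv: "(\<lambda>N. \<Sum>k<N. f k i) \<longlonglongrightarrow> y i" for i
      by (rule nrm_tendsto_imp_coordinate_tendsto[OF sum_mem y lim]) (rule fL)
    have fy: "f p i \<le> y i" for p i
    proof -
      have "(\<lambda>N. (\<Sum>k<N. Re (f k i))) \<longlonglongrightarrow> Re (y i)" "(\<lambda>N. (\<Sum>k<N. Im (f k i))) \<longlonglongrightarrow> Im (y i)"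
        using tendsto_Re[OF conv[of i]] tendsto_Im[OF conv[of i]] by simp_all
      moreover have "Im (f k i) = 0" "Re (f k i) \<ge> 0" for k
        using f0[of k i] by (simp_all add: less_eq_complex_def)
      moreover have "Re (f p i) \<le> Re (y i)"
      proof (rule tendsto_lowerbound[OF calculation(1)])
        show "\<forall>\<^sub>F N in sequentially. Re (f p i) \<le> (\<Sum>k<N. Re (f k i))"
          using eventually_gt_at_top[of p]
          by eventually_elim (auto intro!: member_le_sum calculation(4))
      qed simp
      ultimately show ?thesis by (simp add: less_eq_complex_def LIMSEQ_const_iff)
    qed
    have big: "real p \<le> nrm (mat_op R a y)" for p
    proof -
      have "real p * 2 ^ p * nrm (x p) \<le> nrm (mat_op R a (abs_seq (x p)))"
        using x[of p] nrm_mono[OF mat_op_mem[OF a abs_seq_mem[OF xL]] cmod_mat_op_le[OF a xL]] by (meson less_imp_le order_trans)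
      then have "real p \<le> (1 / (2 ^ p * nrm (x p))) * nrm (mat_op R a (abs_seq (x p)))"
        using x0[of p] by (simp add: field_simps)
      also have "\<dots> = nrm (mat_op R a (f p))"
        unfolding f_def mat_op_scale nrm_scale[OF mat_op_mem[OF a abs_seq_mem[OF xL]]]
        using x0[of p] by (simp add: norm_mult norm_divide norm_power)
      also have "\<dots> \<le> nrm (mat_op R a y)"
        by (intro nrm_mono mat_op_mem[OF a y] cmod_mono_nonneg mat_op_nonneg[OF a fL f0] mat_op_mono[OF a fL y fy])
      finally show ?thesis .
    qed
    obtain p where "real p > nrm (mat_op R a y)" using reals_Archimedean2 by blast
    with big[of p] show False by simp
  qed
  then obtain B where B: "\<And>x. x \<in> L \<Longrightarrow> nrm (mat_op R a x) \<le> B * nrm x" by blast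
  show thesis
  proof (rule that[of "max B 1"])
    fix x assume "x \<in> L"
    then show "nrm (mat_op R a x) \<le> max B 1 * nrm x"
      using B[of x] mult_right_mono[OF max.cobounded1[of B 1] nrm_nonneg[of x]] by linarith
  qed simp
qed

section \<open>Products and powers of operator matrices\<close>

lemma mat_op_unit_seq:
  assumes "i \<in> R" "j \<in> R"
  shows "mat_op R a (unit_seq j) i = of_real (a i j)"
proof -
  have "((\<lambda>p. of_real (a i p) * unit_seq j p) has_sum of_real (a i j)) R"
    by (rule has_sum_finite_neutralI[of "{j}"]) (use assms in \<open>auto simp: unit_seq_def\<close>)
  then show ?thesis using assms by (simp add: mat_op_def infsumI)
qed

lemma operator_matrix_entries_eqI:
  assumes "\<And>x. x \<in> L \<Longrightarrow> mat_op R a x = mat_op R b x" "i \<in> R" "j \<in> R"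
  shows "a i j = b i j"
  using assms(1)[OF unit_seq_mem[OF assms(3)]] mat_op_unit_seq[OF assms(2,3)] by (metis of_real_eq_iff)

text \<open>
  As \<open>a\<^sub>i\<^sub>j\<close> is a coordinate of \<open>a e\<^sub>j\<close> and \<open>\<parallel>e\<^sub>j\<parallel> = 1\<close>, every entry is at most the operator norm.
\<close>

lemma entry_le_bound:
  assumes "operator_matrix a" "\<And>x. x \<in> L \<Longrightarrow> nrm (mat_op R a x) \<le> c * nrm x" "i \<in> R" "j \<in> R"
  shows "a i j \<le> c"
proof -
  have "a i j \<le> cmod (mat_op R a (unit_seq j) i)"
    using mat_op_unit_seq[OF assms(3,4)] by simp
  also have "\<dots> \<le> nrm (mat_op R a (unit_seq j))"
    by (intro coordinate_le_nrm mat_op_mem assms unit_seq_mem)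
  also have "\<dots> \<le> c" using assms(2)[OF unit_seq_mem] assms(4) by (simp add: nrm_unit_seq)
  finally show ?thesis .
qed

text \<open>
  Column \<open>j\<close> of \<open>b\<close> is \<open>b e\<^sub>j \<in> L\<close>, so row \<open>i\<close> of \<open>a\<close> can be applied to it.
\<close>

lemma mat_mult_entry_summable:
  assumes a: "operator_matrix a" and b: "operator_matrix b" and i: "i \<in> R" and j: "j \<in> R"
  shows "(\<lambda>p. a i p * b p j) summable_on R"
proof -
  have "(\<lambda>p. of_real (a i p) * mat_op R b (unit_seq j) p) summable_on R"
    by (intro row_summable[OF a _ i] mat_op_mem[OF b] unit_seq_mem[OF j])
  then have "(\<lambda>p. complex_of_real (a i p * b p j)) summable_on R"
    by (rule back_subst[of "\<lambda>X. X"]) (intro summable_on_cong, simp add: mat_op_unit_seq j)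
  from summable_on_Re[OF this] show ?thesis by simp
qed

text \<open>
  Fubini for the family \<open>a\<^sub>i\<^sub>p b\<^sub>p\<^sub>j x\<^sub>j\<close>. It is absolutely summable because the iterated sum of the
  absolute values is \<open>(a (b \<bar>x\<bar>))\<^sub>i\<close>, which converges since \<open>b \<bar>x\<bar> \<in> L\<close>.
\<close>

lemma mat_op_mat_mult:
  assumes a: "operator_matrix a" and b: "operator_matrix b"
  shows "operator_matrix (mat_mult R a b)"
    and "x \<in> L \<Longrightarrow> mat_op R (mat_mult R a b) x = mat_op R a (mat_op R b x)"
proof -
  have main: "(\<lambda>j. of_real (mat_mult R a b i j) * x j) summable_on R \<and>
      mat_op R (mat_mult R a b) x i = mat_op R a (mat_op R b x) i"
    if x: "x \<in> L" and i: "i \<in> R" for x i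
  proof -
    define F where "F p j = complex_of_real (a i p) * (of_real (b p j) * x j)" for p j
    have inner: "(\<lambda>j. cmod (F p j)) summable_on R \<and>
        (\<Sum>\<^sub>\<infinity>j\<in>R. cmod (F p j)) = cmod (of_real (a i p) * mat_op R b (abs_seq x) p)" if p: "p \<in> R" for p
    proof -
      have s: "(\<lambda>j. of_real (b p j) * abs_seq x j) summable_on R"
        by (rule row_summable[OF b abs_seq_mem[OF x] p])
      have eq: "cmod (F p j) = a i p * cmod (of_real (b p j) * abs_seq x j)" for j
        using operator_matrix_nonneg[OF a i p] by (simp add: F_def abs_seq_def norm_mult)
      have "(\<lambda>j. cmod (of_real (b p j) * abs_seq x j)) summable_on R"
        by (rule iffD1[OF summable_on_iff_abs_summable_on_complex s])
      moreover have "(\<Sum>\<^sub>\<infinity>j\<in>R. cmod (of_real (b p j) * abs_seq x j)) = cmod (mat_op R b (abs_seq x) p)"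
        using p operator_matrix_nonneg[OF b p]
        by (subst infsum_cmod[OF s]) (auto simp: mat_op_def abs_seq_def less_eq_complex_def)
      ultimately show ?thesis
        using operator_matrix_nonneg[OF a i p] unfolding eq
        by (auto simp: infsum_cmult_right' norm_mult intro: summable_on_cmult_right)
    qed
    have "(\<lambda>p. cmod (of_real (a i p) * mat_op R b (abs_seq x) p)) summable_on R"
      by (rule iffD1[OF summable_on_iff_abs_summable_on_complex row_summable[OF a mat_op_mem[OF b abs_seq_mem[OF x]] i]])
    then have "(\<lambda>p. \<Sum>\<^sub>\<infinity>j\<in>R. cmod (F p j)) summable_on R"
      by (rule back_subst[of "\<lambda>X. X"]) (intro summable_on_cong, simp add: inner)
    then have "(\<lambda>p. norm (\<Sum>\<^sub>\<infinity>j\<in>R. cmod (F p j))) summable_on R"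
      by (simp add: infsum_nonneg)
    then have "(\<lambda>z. cmod (case z of (p, j) \<Rightarrow> F p j)) summable_on (R \<times> R)"
      using inner by (subst Infinite_Sum.abs_summable_on_Sigma_iff) auto
    then have F: "(\<lambda>(p, j). F p j) summable_on (R \<times> R)"
      by (rule iffD2[OF summable_on_iff_abs_summable_on_complex])
    have col: "(\<Sum>\<^sub>\<infinity>p\<in>R. F p j) = of_real (mat_mult R a b i j) * x j" if j: "j \<in> R" for j
    proof -
      have "((\<lambda>p. a i p * b p j) has_sum mat_mult R a b i j) R"
        using mat_mult_entry_summable[OF a b i j] by (simp add: mat_mult_def)
      from has_sum_cmult_left[OF has_sum_of_real[OF this], of "x j"]
      show ?thesis by (intro infsumI) (simp add: F_def mult.assoc)
    qed
    have "(\<lambda>j. \<Sum>\<^sub>\<infinity>p\<in>R. F p j) summable_on R"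
      using F summable_on_swap[of "\<lambda>(p, j). F p j" R R] summable_on_Sigma_banach[of "\<lambda>j p. F p j" R "\<lambda>_. R"]
      by auto
    then have "(\<lambda>j. of_real (mat_mult R a b i j) * x j) summable_on R"
      by (rule back_subst[of "\<lambda>X. X"]) (intro summable_on_cong col)
    moreover have "mat_op R a (mat_op R b x) i = (\<Sum>\<^sub>\<infinity>p\<in>R. \<Sum>\<^sub>\<infinity>j\<in>R. F p j)"
      using i by (auto simp: mat_op_def F_def infsum_cmult_right' intro!: infsum_cong)
    moreover have "\<dots> = (\<Sum>\<^sub>\<infinity>j\<in>R. \<Sum>\<^sub>\<infinity>p\<in>R. F p j)"
      by (rule infsum_swap_banach[OF F])
    moreover have "\<dots> = mat_op R (mat_mult R a b) x i"
      using i by (auto simp: mat_op_def intro!: infsum_cong col)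
    ultimately show ?thesis by simp
  qed
  show eq: "mat_op R (mat_mult R a b) x = mat_op R a (mat_op R b x)" if "x \<in> L" for x
  proof
    show "mat_op R (mat_mult R a b) x i = mat_op R a (mat_op R b x) i" for i
      using main[OF that] by (cases "i \<in> R") (auto simp: mat_op_def)
  qed
  show "operator_matrix (mat_mult R a b)"
    unfolding operator_matrix_def defines_operator_def nonneg_matrix_def
    using main eq mat_op_mem[OF a mat_op_mem[OF b]]
    by (auto simp: mat_mult_def operator_matrix_nonneg[OF a] operator_matrix_nonneg[OF b] intro!: infsum_nonneg)
qed

lemma mat_op_mat_power_0: "x \<in> L \<Longrightarrow> mat_op R (mat_power R a 0) x = x"
  and operator_matrix_mat_power_0: "operator_matrix (mat_power R a 0)"
proof -
  have *: "((\<lambda>j. of_real (mat_power R a 0 i j) * x j) has_sum x i) R" if "i \<in> R" for i and x :: "nat \<Rightarrow> complex"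
    by (rule has_sum_finite_neutralI[of "{i}"]) (use that in auto)
  show eq: "mat_op R (mat_power R a 0) x = x" if "x \<in> L" for x
    using infsumI[OF *, of _ x] supported[OF that] by (auto simp: mat_op_def fun_eq_iff)
  show "operator_matrix (mat_power R a 0)"
    unfolding operator_matrix_def defines_operator_def nonneg_matrix_def
    using eq has_sum_imp_summable[OF *] by auto
qed

lemma mat_op_mat_power:
  assumes a: "operator_matrix a"
  shows "operator_matrix (mat_power R a k)"
    and "x \<in> L \<Longrightarrow> mat_op R (mat_power R a k) x = (mat_op R a ^^ k) x"
proof -
  have "operator_matrix (mat_power R a k) \<and> (\<forall>x\<in>L. mat_op R (mat_power R a k) x = (mat_op R a ^^ k) x)"
  proof (induction k)
    case 0
    then show ?case using mat_op_mat_power_0 operator_matrix_mat_power_0 by simp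
  next
    case (Suc k)
    then show ?case using mat_op_mat_mult[OF a, of "mat_power R a k"] by simp
  qed
  then show "operator_matrix (mat_power R a k)"
    and "x \<in> L \<Longrightarrow> mat_op R (mat_power R a k) x = (mat_op R a ^^ k) x" by auto
qed

lemma funpow_mem: "operator_matrix a \<Longrightarrow> x \<in> L \<Longrightarrow> (mat_op R a ^^ k) x \<in> L"
  by (induction k) (auto intro: mat_op_mem)

lemma nrm_funpow_le:
  assumes a: "operator_matrix a" and B: "0 \<le> B" "\<And>x. x \<in> L \<Longrightarrow> nrm (mat_op R a x) \<le> B * nrm x"
    and x: "x \<in> L"
  shows "nrm ((mat_op R a ^^ k) x) \<le> B ^ k * nrm x"
proof (induction k)
  case (Suc k)
  have "nrm ((mat_op R a ^^ Suc k) x) \<le> B * nrm ((mat_op R a ^^ k) x)"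
    using B(2)[OF funpow_mem[OF a x]] by simp
  also have "\<dots> \<le> B * (B ^ k * nrm x)" using Suc B(1) by (intro mult_left_mono) auto
  finally show ?case by (simp add: mult_ac)
qed simp

lemma mat_power_mat_power:
  assumes a: "operator_matrix a" and "i \<in> R" "j \<in> R"
  shows "mat_power R (mat_power R a m) l i j = mat_power R a (m * l) i j"
proof (rule operator_matrix_entries_eqI)
  fix x assume x: "x \<in> L"
  have "mat_op R (mat_power R (mat_power R a m) l) x = (mat_op R (mat_power R a m) ^^ l) x"
    by (rule mat_op_mat_power(2)[OF mat_op_mat_power(1)[OF a] x])
  also have "\<dots> = ((mat_op R a ^^ m) ^^ l) x"
  proof (induction l)
    case (Suc l)
    have "(mat_op R (mat_power R a m) ^^ l) x \<in> L"
      by (rule funpow_mem[OF mat_op_mat_power(1)[OF a] x])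
    then show ?case using Suc mat_op_mat_power(2)[OF a] by simp
  qed simp
  also have "\<dots> = mat_op R (mat_power R a (m * l)) x"
    by (simp add: funpow_mult mat_op_mat_power(2)[OF a x] mult.commute)
  finally show "mat_op R (mat_power R (mat_power R a m) l) x = mat_op R (mat_power R a (m * l)) x" .
qed (use assms in auto)

section \<open>The spectral radius of a nonnegative matrix as a growth rate\<close>

text \<open>
  The numbers \<open>\<mu>\<close> for which \<open>\<parallel>a\<^sup>k\<parallel> = O(\<mu>\<^sup>k)\<close>. Their infimum is the spectral radius: this is Gelfand's
  formula in the form in which it is used, since growth bounds are easy to compare entrywise.
\<close>

definition growth_bound :: "(nat \<Rightarrow> nat \<Rightarrow> real) \<Rightarrow> real \<Rightarrow> bool" where
  "growth_bound a \<mu> \<longleftrightarrow> (\<exists>C>0. \<forall>k. \<forall>x\<in>L. nrm (mat_op R (mat_power R a k) x) \<le> C * \<mu> ^ k * nrm x)"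

definition shifted :: "(nat \<Rightarrow> nat \<Rightarrow> real) \<Rightarrow> complex \<Rightarrow> (nat \<Rightarrow> complex) \<Rightarrow> nat \<Rightarrow> complex" where
  "shifted a z x = (\<lambda>i. z * x i - mat_op R a x i)"

lemma shifted_mem: "operator_matrix a \<Longrightarrow> x \<in> L \<Longrightarrow> shifted a z x \<in> L"
  unfolding shifted_def by (intro minus_mem scale_mem mat_op_mem)

lemma shifted_add:
  "operator_matrix a \<Longrightarrow> x \<in> L \<Longrightarrow> y \<in> L \<Longrightarrow>
    shifted a z (\<lambda>i. x i + y i) = (\<lambda>i. shifted a z x i + shifted a z y i)"
  by (auto simp: shifted_def mat_op_add algebra_simps)

lemma shifted_scale: "shifted a z (\<lambda>i. c * x i) = (\<lambda>i. c * shifted a z x i)"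
  by (auto simp: shifted_def mat_op_scale algebra_simps)

lemma shifted_diff:
  "operator_matrix a \<Longrightarrow> x \<in> L \<Longrightarrow> y \<in> L \<Longrightarrow>
    shifted a z (\<lambda>i. x i - y i) = (\<lambda>i. shifted a z x i - shifted a z y i)"
  by (auto simp: shifted_def mat_op_diff algebra_simps)

lemma shifted_bounded:
  assumes a: "operator_matrix a"
  obtains B where "B > 0" "\<And>x. x \<in> L \<Longrightarrow> nrm (shifted a z x) \<le> B * nrm x"
proof -
  obtain B where B: "B > 0" "\<And>x. x \<in> L \<Longrightarrow> nrm (mat_op R a x) \<le> B * nrm x"
    using mat_op_bounded[OF a] by metis
  show thesis
  proof (rule that[of "cmod z + B"])
    fix x assume x: "x \<in> L"
    show "nrm (shifted a z x) \<le> (cmod z + B) * nrm x"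
      using nrm_triangle_minus[OF scale_mem[OF x, of z] mat_op_mem[OF a x]] B(2)[OF x] nrm_scale[OF x, of z]
      by (simp add: shifted_def distrib_right)
  qed (use B in \<open>simp add: add_nonneg_pos\<close>)
qed

lemma bounded_op_shifted:
  assumes a: "operator_matrix a" shows "bounded_op L nrm (shifted a z)"
proof -
  obtain B where B: "\<And>x. x \<in> L \<Longrightarrow> nrm (shifted a z x) \<le> B * nrm x"
    using shifted_bounded[OF a] by metis
  show ?thesis
    unfolding bounded_op_def
    by (intro conjI ballI allI exI[of _ B] shifted_mem[OF a] shifted_add[OF a] shifted_scale B)
qed

text \<open>
  Invertibility as a lower bound together with surjectivity; no inverse operator has to be
  carried along below.
\<close>

lemma invertible_shifted_iff:
  assumes a: "operator_matrix a"
  shows "invertible_op L nrm (shifted a z) \<longleftrightarrow>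
    (\<exists>M>0. \<forall>y\<in>L. nrm y \<le> M * nrm (shifted a z y)) \<and> (\<forall>x\<in>L. \<exists>y\<in>L. shifted a z y = x)"
    (is "_ = (?below \<and> ?surj)")
proof
  assume "invertible_op L nrm (shifted a z)"
  then obtain S where S: "bounded_op L nrm S" "\<And>x. x \<in> L \<Longrightarrow> S (shifted a z x) = x"
      "\<And>x. x \<in> L \<Longrightarrow> shifted a z (S x) = x"
    unfolding invertible_op_def by blast
  obtain B where B: "\<And>x. x \<in> L \<Longrightarrow> nrm (S x) \<le> B * nrm x"
    using S(1) unfolding bounded_op_def by blast
  have "nrm y \<le> max B 1 * nrm (shifted a z y)" if "y \<in> L" for y
  proof -
    note mem = shifted_mem[OF a that, of z]
    have "nrm y \<le> B * nrm (shifted a z y)" using B[OF mem] S(2)[OF that] by simp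
    also have "\<dots> \<le> max B 1 * nrm (shifted a z y)"
      by (intro mult_right_mono nrm_nonneg mem) simp
    finally show ?thesis .
  qed
  moreover have "max B 1 > 0" by simp
  moreover have "\<exists>y\<in>L. shifted a z y = x" if "x \<in> L" for x
    using S(1,3) that unfolding bounded_op_def by blast
  ultimately show "?below \<and> ?surj" by blast
next
  assume *: "?below \<and> ?surj"
  then obtain M where M: "\<And>y. y \<in> L \<Longrightarrow> nrm y \<le> M * nrm (shifted a z y)" by blast
  obtain S where S: "\<And>x. x \<in> L \<Longrightarrow> S x \<in> L" "\<And>x. x \<in> L \<Longrightarrow> shifted a z (S x) = x"
    using * by metis
  have inj: "x = y" if "x \<in> L" "y \<in> L" "shifted a z x = shifted a z y" for x y
  proof -
    have "shifted a z (\<lambda>i. x i - y i) = (\<lambda>i. 0)"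
      unfolding shifted_diff[OF a that(1,2)] that(3) by simp
    then have "nrm (\<lambda>i. x i - y i) \<le> M * nrm (\<lambda>i. 0)"
      using M[OF minus_mem[OF that(1,2)]] by metis
    then have "(\<lambda>i. x i - y i) = (\<lambda>i. 0)"
      using nrm_nonneg[OF minus_mem[OF that(1,2)]] nrm_eq_0D[OF minus_mem[OF that(1,2)]]
      by (simp add: nrm_zero)
    then show ?thesis by (auto simp: fun_eq_iff)
  qed
  have "bounded_op L nrm S"
    unfolding bounded_op_def
  proof (intro conjI ballI allI exI[of _ M])
    fix x y assume x: "x \<in> L" and y: "y \<in> L"
    show "S (\<lambda>i. x i + y i) = (\<lambda>i. S x i + S y i)"
      by (rule inj[OF S(1)[OF add_mem[OF x y]] add_mem[OF S(1)[OF x] S(1)[OF y]]])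
         (simp only: shifted_add[OF a S(1)[OF x] S(1)[OF y]] S(2)[OF add_mem[OF x y]] S(2)[OF x] S(2)[OF y])
  next
    fix c x assume x: "x \<in> L"
    show "S (\<lambda>i. c * x i) = (\<lambda>i. c * S x i)"
      by (rule inj[OF S(1)[OF scale_mem[OF x]] scale_mem[OF S(1)[OF x]]])
         (simp only: shifted_scale S(2)[OF scale_mem[OF x]] S(2)[OF x])
  next
    fix x assume "x \<in> L"
    then show "nrm (S x) \<le> M * nrm x" using M[OF S(1)] S(2) by simp
  qed (use S in auto)
  moreover have "S (shifted a z x) = x" if "x \<in> L" for x
    by (rule inj[OF S(1)[OF shifted_mem[OF a that]] that S(2)[OF shifted_mem[OF a that]]])
  ultimately show "invertible_op L nrm (shifted a z)"
    unfolding invertible_op_def using bounded_op_shifted[OF a] S by blast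
qed

text \<open>
  The Neumann series \<open>\<Sum>\<^sub>k a\<^sup>k x / z\<^sup>k\<^sup>+\<^sup>1\<close> converges in \<open>L\<close> and solves \<open>z y - a y = x\<close>; the solution is
  unique because \<open>a y = z y\<close> would make \<open>a\<^sup>k y\<close> grow like \<open>\<bar>z\<bar>\<^sup>k\<close>.
\<close>

lemma growth_bound_imp_invertible:
  assumes a: "operator_matrix a" and g: "growth_bound a \<mu>" and \<mu>: "0 < \<mu>" and z: "\<mu> < cmod z"
  shows "invertible_op L nrm (shifted a z)"
proof -
  obtain C where C: "C > 0" "\<And>k x. x \<in> L \<Longrightarrow> nrm ((mat_op R a ^^ k) x) \<le> C * \<mu> ^ k * nrm x"
    using g mat_op_mat_power(2)[OF a] unfolding growth_bound_def by metis
  define q where "q = \<mu> / cmod z"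
  have q: "0 < q" "q < 1" using \<mu> z by (auto simp: q_def divide_simps)
  have z0: "z \<noteq> 0" "cmod z > 0" using \<mu> z by auto
  have qk: "q ^ k * cmod z ^ k = \<mu> ^ k" for k
    using z0 by (simp add: q_def power_divide)
  define K where "K = C / cmod z / (1 - q)"
  have K: "K > 0" using C q z0 by (simp add: K_def)
  have solve: "\<exists>y\<in>L. shifted a z y = x \<and> nrm y \<le> K * nrm x" if x: "x \<in> L" for x
  proof -
    define t where "t k = (\<lambda>i. (1 / z ^ k) * (mat_op R a ^^ k) x i)" for k
    have tL: "t k \<in> L" for k
      unfolding t_def by (intro scale_mem funpow_mem a x)
    have nt: "nrm (t k) \<le> C * nrm x * q ^ k" for k
    proof -
      have "nrm (t k) = nrm ((mat_op R a ^^ k) x) / cmod z ^ k"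
        unfolding t_def nrm_scale[OF funpow_mem[OF a x]] by (simp add: norm_divide norm_power)
      also have "\<dots> \<le> C * \<mu> ^ k * nrm x / cmod z ^ k"
        using C(2)[OF x] by (intro divide_right_mono) auto
      also have "\<dots> = C * nrm x * q ^ k" by (simp add: q_def power_divide)
      finally show ?thesis .
    qed
    define f where "f k = (\<lambda>i. (1 / z) * t k i)" for k
    have fL: "f k \<in> L" for k unfolding f_def by (intro scale_mem tL)
    have nf: "nrm (f k) \<le> C * nrm x / cmod z * q ^ k" for k
      using divide_right_mono[OF nt[of k], of "cmod z"] nrm_scale[OF tL, of "1 / z" k]
      by (simp add: f_def norm_divide)
    have sf: "summable (\<lambda>k. C * nrm x / cmod z * q ^ k)"
      using q by (intro summable_mult summable_geometric) auto
    obtain y where y: "y \<in> L" and lim: "(\<lambda>N. nrm (\<lambda>i. (\<Sum>k<N. f k i) - y i)) \<longlonglongrightarrow> 0"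
      by (rule absolutely_convergent_series[of f, OF fL nf sf])
    define X where "X N = (\<lambda>i. \<Sum>k<N. f k i)" for N :: nat
    have XL: "X N \<in> L" for N unfolding X_def by (intro sum_mem fL)
    have lim: "(\<lambda>N. nrm (\<lambda>i. X N i - y i)) \<longlonglongrightarrow> 0" using lim by (simp add: X_def)
    have step: "shifted a z (f k) = (\<lambda>i. t k i - t (Suc k) i)" for k
    proof -
      have "mat_op R a (t k) = (\<lambda>i. z * t (Suc k) i)"
        unfolding t_def mat_op_scale using z0 by simp
      then show ?thesis
        unfolding f_def shifted_scale using z0 by (auto simp: shifted_def fun_eq_iff right_diff_distrib)
    qed
    have DX: "shifted a z (X N) = (\<lambda>i. x i - t N i)" for N
    proof (induction N)
      case 0
      then show ?case by (auto simp: X_def t_def mat_op_def shifted_def fun_eq_iff)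
    next
      case (Suc N)
      have "X (Suc N) = (\<lambda>i. X N i + f N i)" by (simp add: X_def)
      then have "shifted a z (X (Suc N)) = (\<lambda>i. shifted a z (X N) i + shifted a z (f N) i)"
        using shifted_add[OF a XL fL, of z] by simp
      then show ?case
        unfolding Suc step by simp
    qed
    obtain B where B: "B > 0" "\<And>x. x \<in> L \<Longrightarrow> nrm (shifted a z x) \<le> B * nrm x"
      using shifted_bounded[OF a] by metis
    have err: "nrm (\<lambda>i. shifted a z y i - x i) \<le> B * nrm (\<lambda>i. X N i - y i) + C * nrm x * q ^ N" for N
    proof -
      have eq: "(\<lambda>i. shifted a z y i - x i) = (\<lambda>i. shifted a z (\<lambda>i. y i - X N i) i - t N i)"
        unfolding shifted_diff[OF a y XL] DX by simp
      have "nrm (\<lambda>i. shifted a z y i - x i) \<le> nrm (shifted a z (\<lambda>i. y i - X N i)) + nrm (t N)"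
        unfolding eq by (intro nrm_triangle_minus shifted_mem[OF a] minus_mem y XL tL)
      also have "\<dots> \<le> B * nrm (\<lambda>i. y i - X N i) + C * nrm x * q ^ N"
        by (intro add_mono B(2) minus_mem y XL nt)
      finally show ?thesis unfolding nrm_minus_commute[OF y XL] .
    qed
    have lq: "(\<lambda>N. q ^ N) \<longlonglongrightarrow> 0" using q by (intro LIMSEQ_power_zero) auto
    have "(\<lambda>N. B * nrm (\<lambda>i. X N i - y i) + C * nrm x * q ^ N) \<longlonglongrightarrow> B * 0 + C * nrm x * 0"
      by (intro tendsto_intros lim lq)
    then have "nrm (\<lambda>i. shifted a z y i - x i) \<le> B * 0 + C * nrm x * 0"
      by (rule LIMSEQ_le_const) (use err in blast)
    then have "nrm (\<lambda>i. shifted a z y i - x i) = 0"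
      using nrm_nonneg[OF minus_mem[OF shifted_mem[OF a y] x], of z] by simp
    then have eq: "shifted a z y = x"
      using nrm_eq_0D[OF minus_mem[OF shifted_mem[OF a y] x], of z] by (auto simp: fun_eq_iff)
    have nX: "nrm (X N) \<le> K * nrm x" for N
    proof -
      have "nrm (X N) \<le> (\<Sum>k<N. nrm (f k))" unfolding X_def by (intro nrm_sum fL)
      also have "\<dots> \<le> (\<Sum>k<N. C * nrm x / cmod z * q ^ k)" by (intro sum_mono nf)
      also have "\<dots> \<le> (\<Sum>k. C * nrm x / cmod z * q ^ k)"
        using C q nrm_nonneg[OF x] by (intro sum_le_suminf sf) auto
      also have "\<dots> = K * nrm x"
        using q by (subst suminf_mult) (auto simp: suminf_geometric K_def summable_geometric)
      finally show ?thesis .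
    qed
    have ny: "nrm y \<le> K * nrm x + nrm (\<lambda>i. X N i - y i)" for N
      using nrm_triangle_minus[OF XL minus_mem[OF XL y], of N N] nX[of N] by simp
    have "(\<lambda>N. K * nrm x + nrm (\<lambda>i. X N i - y i)) \<longlonglongrightarrow> K * nrm x + 0"
      by (intro tendsto_intros lim)
    then have "nrm y \<le> K * nrm x + 0"
      by (rule LIMSEQ_le_const) (use ny in blast)
    with y eq show ?thesis by auto
  qed
  have inj: "x = (\<lambda>i. 0)" if x: "x \<in> L" and Dx: "shifted a z x = (\<lambda>i. 0)" for x
  proof -
    have "mat_op R a x = (\<lambda>i. z * x i)" using fun_cong[OF Dx] by (auto simp: shifted_def fun_eq_iff)
    then have "(mat_op R a ^^ k) x = (\<lambda>i. z ^ k * x i)" for k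
      by (induction k) (auto simp: mat_op_scale mult.assoc mult.left_commute)
    then have "cmod z ^ k * nrm x \<le> C * \<mu> ^ k * nrm x" for k
      using C(2)[OF x, of k] nrm_scale[OF x, of "z ^ k"] by (simp add: norm_power)
    then have "nrm x * cmod z ^ k \<le> C * nrm x * q ^ k * cmod z ^ k" for k
      using qk[of k] by (simp add: mult_ac)
    then have le: "nrm x \<le> C * nrm x * q ^ k" for k
      using z0 by (meson mult_right_le_imp_le zero_less_power)
    have "(\<lambda>k. C * nrm x * q ^ k) \<longlonglongrightarrow> C * nrm x * 0"
      using q by (intro tendsto_intros LIMSEQ_power_zero) auto
    then have "nrm x \<le> C * nrm x * 0"
      by (rule LIMSEQ_le_const) (use le in blast)
    then show ?thesis using nrm_nonneg[OF x] nrm_eq_0D[OF x] by simp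
  qed
  have below: "nrm y \<le> K * nrm (shifted a z y)" if y: "y \<in> L" for y
  proof -
    obtain y' where y': "y' \<in> L" "shifted a z y' = shifted a z y" "nrm y' \<le> K * nrm (shifted a z y)"
      using solve[OF shifted_mem[OF a y]] by metis
    have "shifted a z (\<lambda>i. y' i - y i) = (\<lambda>i. 0)"
      unfolding shifted_diff[OF a y'(1) y] y'(2) by simp
    then have "(\<lambda>i. y' i - y i) = (\<lambda>i. 0)" by (rule inj[OF minus_mem[OF y'(1) y]])
    then have "y' = y" by (auto simp: fun_eq_iff)
    with y'(3) show ?thesis by simp
  qed
  show ?thesis
    unfolding invertible_shifted_iff[OF a] using K below solve by blast
qed

text \<open>
  The converse half of Gelfand's formula. Positivity replaces complex analysis here, and
  only the positive half-line has to lie in the resolvent set.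

  If \<open>\<mu> - a\<close> has a positive inverse, put \<open>y = (\<mu> - a)\<^sup>-\<^sup>1 \<bar>x\<bar> \<ge> 0\<close>. Then \<open>\<mu> y = \<bar>x\<bar> + a y\<close> dominates both
  \<open>\<bar>x\<bar>\<close> and \<open>a y\<close>, hence \<open>a\<^sup>k \<bar>x\<bar> \<le> \<mu> a\<^sup>k y \<le> \<mu>\<^sup>k\<^sup>+\<^sup>1 y\<close>, which is the growth bound.

  It remains to see that the inverse is positive. This holds for \<open>t - a\<close> with \<open>t > \<parallel>a\<parallel>\<close>, and it
  is inherited from \<open>t\<close> by every smaller \<open>s\<close> with \<open>(t - s) \<parallel>(t - a)\<^sup>-\<^sup>1\<parallel> < 1\<close>. As the norms of the
  resolvents are locally bounded, the infimum of the \<open>t \<ge> \<mu>\<close> with positive inverse is attained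
  and equal to \<open>\<mu>\<close>.
\<close>

lemma invertible_imp_growth_bound:
  assumes a: "operator_matrix a" and \<mu>: "0 < \<mu>"
    and inv: "\<And>t. \<mu> \<le> t \<Longrightarrow> invertible_op L nrm (shifted a (of_real t))"
  shows "growth_bound a \<mu>"
proof -
  define D where "D t = shifted a (complex_of_real t)" for t
  have D_mem: "D t x \<in> L" if "x \<in> L" for t x
    unfolding D_def by (rule shifted_mem[OF a that])
  have D_shift: "D t y i = D s y i + of_real (t - s) * y i" for s t y i
    by (simp add: D_def shifted_def algebra_simps)
  have below: "\<exists>M>0. \<forall>y\<in>L. nrm y \<le> M * nrm (D t y)" and surj: "\<And>x. x \<in> L \<Longrightarrow> \<exists>y\<in>L. D t y = x"
    if "\<mu> \<le> t" for t
    using inv[OF that] unfolding invertible_shifted_iff[OF a] D_def by blast+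
  \<comment> \<open>The inverse of \<open>t - a\<close> is positive.\<close>
  define Pos where "Pos t \<longleftrightarrow> (\<forall>y\<in>L. (\<forall>i. 0 \<le> D t y i) \<longrightarrow> (\<forall>i. 0 \<le> y i))" for t
  \<comment> \<open>\<open>y\<close> and its conjugate solve the same equation.\<close>
  have real_solution: "Im (y i) = 0" if t: "\<mu> \<le> t" and y: "y \<in> L" and pos: "\<And>i. 0 \<le> D t y i" for t y i
  proof -
    obtain M where M: "\<And>y. y \<in> L \<Longrightarrow> nrm y \<le> M * nrm (D t y)" using below[OF t] by blast
    define u where "u = (\<lambda>i. y i - cnj (y i))"
    have cy: "(\<lambda>i. cnj (y i)) \<in> L" using solid[OF y, of "\<lambda>i. cnj (y i)"] by simp
    have uL: "u \<in> L" unfolding u_def by (rule minus_mem[OF y cy])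
    have "D t u = (\<lambda>i. D t y i - cnj (D t y i))"
      unfolding u_def D_def shifted_diff[OF a y cy] by (simp add: shifted_def mat_op_cnj)
    also have "\<dots> = (\<lambda>i. 0)"
      using pos by (auto simp: fun_eq_iff less_eq_complex_def complex_eq_iff)
    finally have "nrm u \<le> 0" using M[OF uL] by (simp add: nrm_zero)
    then have "u = (\<lambda>i. 0)" using nrm_nonneg[OF uL] nrm_eq_0D[OF uL] by simp
    then have "y i - cnj (y i) = 0" unfolding u_def by (rule fun_cong)
    then show ?thesis by (simp add: complex_eq_iff)
  qed
  define neg where "neg y = (\<lambda>i. complex_of_real (max 0 (- Re (y i))))" for y :: "nat \<Rightarrow> complex"
  have neg_mem: "neg y \<in> L" if "y \<in> L" for y
  proof -
    have "cmod (neg y i) \<le> cmod (y i)" for i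
      using abs_Re_le_cmod[of "y i"] by (auto simp: neg_def)
    then show ?thesis using solid[OF that] by blast
  qed
  have neg_nonneg: "0 \<le> neg y i" for y i by (simp add: neg_def less_eq_complex_def)
  have add_neg: "0 \<le> y i + neg y i" if "Im (y i) = 0" for y i
    using that by (auto simp: neg_def less_eq_complex_def)
  \<comment> \<open>\<open>y + v \<ge> 0\<close> means that \<open>v\<close> dominates the negative part of \<open>y\<close>; so the latter is
    0 if the norm of \<open>v\<close> is smaller by a factor below 1.\<close>
  have nonneg_if_neg_contracts: "\<forall>i. 0 \<le> y i"
    if y: "y \<in> L" and im: "\<And>i. Im (y i) = 0" and v: "v \<in> L"
      and yv: "\<And>i. 0 \<le> y i + v i" and v0: "\<And>i. 0 \<le> v i" and nv: "nrm v \<le> c * nrm (neg y)" and c: "c < 1" for y v c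
  proof -
    have "cmod (neg y i) \<le> cmod (v i)" for i
      using yv[of i] v0[of i] by (auto simp: neg_def less_eq_complex_def cmod_eq_Re)
    then have "nrm (neg y) \<le> c * nrm (neg y)" using nrm_mono[OF v] nv by (meson order_trans)
    then have "(1 - c) * nrm (neg y) \<le> 0" by (simp add: algebra_simps)
    then have "nrm (neg y) = 0"
      using c nrm_nonneg[OF neg_mem[OF y]] by (simp add: mult_le_0_iff)
    then have "neg y = (\<lambda>i. 0)" by (rule nrm_eq_0D[OF neg_mem[OF y]])
    then have "max 0 (- Re (y i)) = 0" for i
      using fun_cong[of "neg y" "\<lambda>i. 0" i] unfolding neg_def by (simp only: of_real_eq_0_iff)
    then have "0 \<le> Re (y i)" for i
      using max.cobounded2[of "- Re (y i)" 0] by (metis neg_le_0_iff_le)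
    then show ?thesis using im by (auto simp: less_eq_complex_def)
  qed
  \<comment> \<open>Here \<open>v = (t - s) (t - a)\<^sup>-\<^sup>1 y\<^sup>-\<close> with the negative part \<open>y\<^sup>-\<close>. If \<open>(s - a) y \<ge> 0\<close>, then
    \<open>(t - a) (y + v) = (s - a) y + (t - s) (y + y\<^sup>-) \<ge> 0\<close>, hence \<open>y + v \<ge> 0\<close>.\<close>
  have Pos_left: "Pos s"
    if st: "\<mu> \<le> s" "s \<le> t" "Pos t" and M: "M > 0" "\<And>y. y \<in> L \<Longrightarrow> nrm y \<le> M * nrm (D t y)" and small: "(t - s) * M < 1" for s t M
    unfolding Pos_def
  proof (intro ballI impI)
    fix y assume y: "y \<in> L" and pos: "\<forall>i. 0 \<le> D s y i"
    have im: "Im (y i) = 0" for i using real_solution[OF st(1) y] pos by blast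
    obtain u where u: "u \<in> L" "D t u = neg y"
      using surj[OF order.trans[OF st(1,2)] neg_mem[OF y]] by blast
    have u0: "0 \<le> u i" for i using \<open>Pos t\<close> u neg_nonneg unfolding Pos_def by metis
    define v where "v = (\<lambda>i. complex_of_real (t - s) * u i)"
    have vL: "v \<in> L" unfolding v_def by (intro scale_mem u)
    have "D t (\<lambda>i. y i + v i) = (\<lambda>i. D s y i + of_real (t - s) * (y i + neg y i))"
    proof -
      have "D t (\<lambda>i. y i + v i) = (\<lambda>i. D t y i + D t v i)"
        unfolding D_def by (rule shifted_add[OF a y vL])
      also have "D t v = (\<lambda>i. of_real (t - s) * neg y i)"
        unfolding v_def D_def shifted_scale unfolding D_def[symmetric] u(2) ..
      finally show ?thesis by (simp add: D_shift[of t y _ s] algebra_simps)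
    qed
    moreover have "0 \<le> D s y i + of_real (t - s) * (y i + neg y i)" for i
    proof -
      have "0 \<le> complex_of_real (t - s)" using st(2) by (simp add: less_eq_complex_def)
      then show ?thesis using pos add_neg[of y i] im by (metis add_nonneg_nonneg mult_nonneg_nonneg)
    qed
    ultimately have yv: "0 \<le> y i + v i" for i
      using \<open>Pos t\<close> add_mem[OF y vL] unfolding Pos_def by metis
    have v0: "0 \<le> v i" for i
      using u0[of i] st(2) by (auto simp: v_def less_eq_complex_def)
    have "nrm v = (t - s) * nrm u" using st(2) unfolding v_def nrm_scale[OF u(1)] by (simp del: of_real_diff)
    also have "\<dots> \<le> (t - s) * (M * nrm (neg y))"
      using M(2)[OF u(1)] st(2) u(2) by (intro mult_left_mono) auto
    finally have "nrm v \<le> ((t - s) * M) * nrm (neg y)" by (simp add: mult.assoc)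
    from nonneg_if_neg_contracts[OF y im vL yv v0 this small] show "\<forall>i. 0 \<le> y i" .
  qed
  obtain B where B: "B > 0" "\<And>x. x \<in> L \<Longrightarrow> nrm (mat_op R a x) \<le> B * nrm x"
    using mat_op_bounded[OF a] by metis
  \<comment> \<open>The same argument with \<open>v = a y\<^sup>- / t\<close>, using \<open>t y + a y\<^sup>- = (t - a) y + a (y + y\<^sup>-)\<close>.\<close>
  have Pos_large: "Pos t" if t: "\<mu> \<le> t" "B < t" for t
    unfolding Pos_def
  proof (intro ballI impI)
    fix y assume y: "y \<in> L" and pos: "\<forall>i. 0 \<le> D t y i"
    have im: "Im (y i) = 0" for i using real_solution[OF t(1) y] pos by blast
    have t0: "t > 0" using t B by simp
    define v where "v = (\<lambda>i. complex_of_real (1 / t) * mat_op R a (neg y) i)"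
    have vL: "v \<in> L" unfolding v_def by (intro scale_mem mat_op_mem a neg_mem y)
    have 1: "0 \<le> complex_of_real (1 / t)" using t0 by (simp add: less_eq_complex_def)
    have v0: "0 \<le> v i" for i
      unfolding v_def by (intro mult_nonneg_nonneg 1 mat_op_nonneg[OF a] neg_mem y neg_nonneg)
    have "y i + v i = of_real (1 / t) * (D t y i + mat_op R a (\<lambda>i. y i + neg y i) i)" for i
      using t0 unfolding mat_op_add[OF a y neg_mem[OF y]] by (simp add: v_def D_def shifted_def field_simps)
    then have yv: "0 \<le> y i + v i" for i
      using pos mat_op_nonneg[OF a add_mem[OF y neg_mem[OF y]]] add_neg[of y] im
      by (metis mult_nonneg_nonneg[OF 1] add_nonneg_nonneg)
    have "nrm v = (1 / t) * nrm (mat_op R a (neg y))"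
      using t0 unfolding v_def nrm_scale[OF mat_op_mem[OF a neg_mem[OF y]]] by (simp add: norm_divide)
    also have "\<dots> \<le> (1 / t) * (B * nrm (neg y))"
      using t0 by (intro mult_left_mono B neg_mem y) auto
    finally have "nrm v \<le> (B / t) * nrm (neg y)" by simp
    moreover have "B / t < 1" using t t0 by simp
    ultimately show "\<forall>i. 0 \<le> y i" by (rule nonneg_if_neg_contracts[OF y im vL yv v0])
  qed
  \<comment> \<open>With \<open>\<delta> = 1 / (4 M)\<close> the bound \<open>M\<close> at the infimum \<open>t\<^sub>0\<close> becomes at most \<open>2 M\<close> at a nearby \<open>t\<close> in
    the set; then positivity passes from \<open>t\<close> to all \<open>s \<ge> \<mu>\<close> with \<open>t - s < 2 \<delta>\<close>, beyond \<open>t\<^sub>0\<close> unless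
    \<open>t\<^sub>0 = \<mu>\<close>.\<close>
  define A where "A = {t. \<mu> \<le> t \<and> Pos t}"
  have "max \<mu> (B + 1) \<in> A" using Pos_large[of "max \<mu> (B + 1)"] by (simp add: A_def less_max_iff_disj)
  then have A_ne: "A \<noteq> {}" by blast
  have A_bdd: "bdd_below A" by (auto simp: A_def bdd_below_def)
  define t0 where "t0 = Inf A"
  have t0: "\<mu> \<le> t0" unfolding t0_def using A_ne by (intro cInf_greatest) (auto simp: A_def)
  obtain M where M: "M > 0" "\<And>y. y \<in> L \<Longrightarrow> nrm y \<le> M * nrm (D t0 y)" using below[OF t0] by blast
  define \<delta> where "\<delta> = 1 / (4 * M)"
  have \<delta>: "\<delta> > 0" "\<delta> * M = 1 / 4" using M by (auto simp: \<delta>_def)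
  obtain t where t: "t \<in> A" "t < t0 + \<delta>"
    using cInf_lessD[OF A_ne, of "t0 + \<delta>"] \<delta> unfolding t0_def by auto
  have t0t: "t0 \<le> t" unfolding t0_def by (rule cInf_lower[OF t(1) A_bdd])
  have Mt: "nrm y \<le> (2 * M) * nrm (D t y)" if y: "y \<in> L" for y
  proof -
    have eq: "D t0 y = (\<lambda>i. D t y i - of_real (t - t0) * y i)"
      by (simp add: D_shift[of t y _ t0])
    have "nrm (D t0 y) \<le> nrm (D t y) + nrm (\<lambda>i. of_real (t - t0) * y i)"
      unfolding eq by (intro nrm_triangle_minus D_mem scale_mem y)
    also have "nrm (\<lambda>i. of_real (t - t0) * y i) = (t - t0) * nrm y"
      using t0t unfolding nrm_scale[OF y] by (simp del: of_real_diff)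
    also have "\<dots> \<le> \<delta> * nrm y" using t nrm_nonneg[OF y] by (intro mult_right_mono) auto
    finally have "M * nrm (D t0 y) \<le> M * (nrm (D t y) + \<delta> * nrm y)" using M(1) by simp
    also have "\<dots> = M * nrm (D t y) + (\<delta> * M) * nrm y" by (simp add: algebra_simps)
    finally have "nrm y \<le> M * nrm (D t y) + nrm y / 4" using M(2)[OF y] \<delta>(2) by simp
    moreover have "0 \<le> M * nrm (D t y)" using M(1) nrm_nonneg[OF D_mem[OF y]] by simp
    ultimately show ?thesis by linarith
  qed
  define s where "s = max \<mu> (t0 - \<delta> / 2)"
  have s: "\<mu> \<le> s" "s \<le> t" "t - s < 2 * \<delta>" using t0 t0t t \<delta> by (auto simp: s_def)
  have "(t - s) * (2 * M) < (2 * \<delta>) * (2 * M)" using s(3) M(1) by (intro mult_strict_right_mono) auto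
  then have "(t - s) * (2 * M) < 1" using \<delta>(2) by simp
  then have "Pos s" using Pos_left[OF s(1,2) _ _ Mt] t(1) M(1) by (simp add: A_def)
  then have "t0 \<le> s" unfolding t0_def using s(1) by (intro cInf_lower[OF _ A_bdd]) (simp add: A_def)
  then have "s = \<mu>" using \<delta> by (auto simp: s_def split: if_splits)
  with \<open>Pos s\<close> have Pos: "Pos \<mu>" by simp
  obtain N where N: "N > 0" "\<And>y. y \<in> L \<Longrightarrow> nrm y \<le> N * nrm (D \<mu> y)" using below[of \<mu>] by blast
  have bound: "nrm (mat_op R (mat_power R a k) x) \<le> (\<mu> * N) * \<mu> ^ k * nrm x" if x: "x \<in> L" for k x
  proof -
    obtain y where y: "y \<in> L" "D \<mu> y = abs_seq x" using surj[of \<mu>] abs_seq_mem[OF x] by blast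
    have ax0: "0 \<le> abs_seq x i" for i by (simp add: abs_seq_def less_eq_complex_def)
    have y0: "0 \<le> y i" for i using Pos y ax0 unfolding Pos_def by metis
    have Dy: "of_real \<mu> * y i = abs_seq x i + mat_op R a y i" for i
      using fun_cong[OF y(2), of i] by (simp add: D_def shifted_def algebra_simps)
    have ay: "mat_op R a y i \<le> of_real \<mu> * y i" for i
      unfolding Dy using ax0[of i] by simp
    have xy: "abs_seq x i \<le> of_real \<mu> * y i" for i
      unfolding Dy using mat_op_nonneg[OF a y(1) y0] by simp
    have pw: "(mat_op R a ^^ k) y i \<le> of_real (\<mu> ^ k) * y i" for i
    proof (induction k arbitrary: i)
      case (Suc k)
      have "(mat_op R a ^^ Suc k) y i \<le> mat_op R a (\<lambda>i. of_real (\<mu> ^ k) * y i) i"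
        using Suc mat_op_mono[OF a funpow_mem[OF a y(1)] scale_mem[OF y(1)]] by simp
      also have "\<dots> \<le> of_real (\<mu> ^ k) * (of_real \<mu> * y i)"
        unfolding mat_op_scale using \<mu> by (intro mult_left_mono ay) (simp add: less_eq_complex_def)
      finally show ?case by (simp add: mult_ac)
    qed simp
    note ak = mat_op_mat_power(1)[OF a, of k]
    have "cmod (mat_op R (mat_power R a k) x i) \<le> cmod (of_real (\<mu> ^ Suc k) * y i)" for i
    proof -
      have "cmod (mat_op R (mat_power R a k) x i) \<le> cmod (mat_op R (mat_power R a k) (abs_seq x) i)"
        by (rule cmod_mat_op_le[OF ak x])
      also have "\<dots> \<le> cmod (of_real (\<mu> ^ Suc k) * y i)"
      proof (rule cmod_mono_nonneg)
        show "0 \<le> mat_op R (mat_power R a k) (abs_seq x) i"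
          by (rule mat_op_nonneg[OF ak abs_seq_mem[OF x] ax0])
        have "mat_op R (mat_power R a k) (abs_seq x) i \<le> mat_op R (mat_power R a k) (\<lambda>i. of_real \<mu> * y i) i"
          by (rule mat_op_mono[OF ak abs_seq_mem[OF x] scale_mem[OF y(1)] xy])
        also have "\<dots> = of_real \<mu> * (mat_op R a ^^ k) y i"
          unfolding mat_op_scale mat_op_mat_power(2)[OF a y(1)] ..
        also have "\<dots> \<le> of_real \<mu> * (of_real (\<mu> ^ k) * y i)"
          using \<mu> by (intro mult_left_mono pw) (simp add: less_eq_complex_def)
        finally show "mat_op R (mat_power R a k) (abs_seq x) i \<le> of_real (\<mu> ^ Suc k) * y i"
          by (simp add: mult_ac)
      qed
      finally show ?thesis .
    qed
    then have "nrm (mat_op R (mat_power R a k) x) \<le> nrm (\<lambda>i. of_real (\<mu> ^ Suc k) * y i)"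
      by (intro nrm_mono[OF scale_mem[OF y(1)]])
    also have "\<dots> = \<mu> ^ Suc k * nrm y" using \<mu> unfolding nrm_scale[OF y(1)] by (simp add: norm_mult norm_power)
    also have "\<dots> \<le> \<mu> ^ Suc k * (N * nrm x)"
      using N(2)[OF y(1)] \<mu> unfolding y(2) nrm_abs_seq[OF x] by (intro mult_left_mono) auto
    finally show ?thesis by (simp add: mult_ac)
  qed
  then show ?thesis unfolding growth_bound_def using N(1) \<mu> by (intro exI[of _ "\<mu> * N"]) auto
qed

lemma op_spectrum_mat_op: "op_spectrum L nrm (mat_op R a) = {z. \<not> invertible_op L nrm (shifted a z)}"
  unfolding op_spectrum_def shifted_def by (rule refl)

lemma growth_bound_exists:
  assumes a: "operator_matrix a"
  obtains B where "B > 0" "growth_bound a B"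
proof -
  obtain B where B: "B > 0" "\<And>x. x \<in> L \<Longrightarrow> nrm (mat_op R a x) \<le> B * nrm x"
    using mat_op_bounded[OF a] by metis
  have "nrm (mat_op R (mat_power R a k) x) \<le> 1 * B ^ k * nrm x" if x: "x \<in> L" for k x
    using nrm_funpow_le[OF a less_imp_le[OF B(1)] B(2) x] by (simp add: mat_op_mat_power(2)[OF a x])
  then have "growth_bound a B" unfolding growth_bound_def by (intro exI[of _ 1]) auto
  with B(1) show thesis by (rule that)
qed

text \<open>
  If the spectrum were empty, then every \<open>\<mu> > 0\<close> would be a growth bound, but \<open>a\<close> would also have
  a bounded inverse, of norm \<open>M\<close> say. The growth bound \<open>1 / (2 M)\<close> contradicts
  \<open>\<parallel>y\<parallel> \<le> M\<^sup>k \<parallel>a\<^sup>k y\<parallel>\<close>. Without this, the supremum in the definition of the spectral radius would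
  be taken over the empty set.
\<close>

lemma op_spectrum_nonempty:
  assumes a: "operator_matrix a"
  shows "op_spectrum L nrm (mat_op R a) \<noteq> {}"
proof
  assume "op_spectrum L nrm (mat_op R a) = {}"
  then have inv: "invertible_op L nrm (shifted a z)" for z
    unfolding op_spectrum_mat_op by blast
  obtain M where M: "M > 0" "\<And>y. y \<in> L \<Longrightarrow> nrm y \<le> M * nrm (shifted a 0 y)"
    using inv[of 0] unfolding invertible_shifted_iff[OF a] by blast
  have below: "nrm y \<le> M * nrm (mat_op R a y)" if "y \<in> L" for y
    using M(2)[OF that] nrm_scale[OF mat_op_mem[OF a that], of "-1"] by (simp add: shifted_def)
  have below_pow: "nrm y \<le> M ^ k * nrm ((mat_op R a ^^ k) y)" if y: "y \<in> L" for y k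
  proof (induction k)
    case (Suc k)
    have "M ^ k * nrm ((mat_op R a ^^ k) y) \<le> M ^ k * (M * nrm ((mat_op R a ^^ Suc k) y))"
      using below[OF funpow_mem[OF a y]] M(1) by (intro mult_left_mono) auto
    with Suc show ?case by (simp add: mult_ac)
  qed simp
  have "growth_bound a (1 / (2 * M))"
    using inv M(1) by (intro invertible_imp_growth_bound[OF a]) auto
  then obtain C where C: "C > 0" "\<And>k x. x \<in> L \<Longrightarrow> nrm ((mat_op R a ^^ k) x) \<le> C * (1 / (2 * M)) ^ k * nrm x"
    using mat_op_mat_power(2)[OF a] unfolding growth_bound_def by metis
  obtain p where p: "p \<in> R" using index_set by force
  have le: "1 \<le> C * (1 / 2) ^ k" for k
  proof -
    have "1 \<le> M ^ k * (C * (1 / (2 * M)) ^ k * 1)"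
      using below_pow[OF unit_seq_mem[OF p], of k] C(2)[OF unit_seq_mem[OF p], of k] M(1)
      by (simp add: nrm_unit_seq p) (meson mult_left_mono order_trans zero_le_power less_imp_le)
    also have "\<dots> = C * (1 / 2) ^ k" using M(1) by (simp add: power_divide power_mult_distrib)
    finally show ?thesis .
  qed
  have "(\<lambda>k. C * (1 / 2) ^ k) \<longlonglongrightarrow> C * 0"
    by (intro tendsto_intros LIMSEQ_power_zero) auto
  then have "1 \<le> C * 0" by (rule LIMSEQ_le_const) (use le in blast)
  then show False by simp
qed

abbreviation radius :: "(nat \<Rightarrow> nat \<Rightarrow> real) \<Rightarrow> real" where
  "radius \<equiv> spectral_radius R L nrm"

lemma spectrum_le_growth_bound:
  "\<lbrakk>operator_matrix a; growth_bound a \<mu>; 0 < \<mu>; z \<in> op_spectrum L nrm (mat_op R a)\<rbrakk> \<Longrightarrow> cmod z \<le> \<mu>"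
  using growth_bound_imp_invertible[of a \<mu> z] unfolding op_spectrum_mat_op by force

lemma radius_le_growth_bound:
  "\<lbrakk>operator_matrix a; growth_bound a \<mu>; 0 < \<mu>\<rbrakk> \<Longrightarrow> radius a \<le> \<mu>"
  unfolding spectral_radius_def op_spectral_radius_def
  using op_spectrum_nonempty spectrum_le_growth_bound by (intro cSup_least) auto

lemma spectrum_le_radius:
  assumes a: "operator_matrix a" and z: "z \<in> op_spectrum L nrm (mat_op R a)"
  shows "cmod z \<le> radius a"
proof -
  obtain B where "B > 0" "growth_bound a B" by (rule growth_bound_exists[OF a])
  then have "bdd_above (cmod ` op_spectrum L nrm (mat_op R a))"
    using spectrum_le_growth_bound[OF a] by (intro bdd_aboveI[of _ B]) auto
  then show ?thesis
    unfolding spectral_radius_def op_spectral_radius_def using z by (intro cSup_upper) auto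
qed

lemma radius_nonneg:
  assumes a: "operator_matrix a" shows "0 \<le> radius a"
proof -
  obtain z where "z \<in> op_spectrum L nrm (mat_op R a)" using op_spectrum_nonempty[OF a] by blast
  from spectrum_le_radius[OF a this] show ?thesis using norm_ge_zero order_trans by blast
qed

lemma radius_less_imp_growth_bound:
  assumes a: "operator_matrix a" and \<mu>: "radius a < \<mu>"
  shows "growth_bound a \<mu>"
proof (rule invertible_imp_growth_bound[OF a])
  show "0 < \<mu>" using radius_nonneg[OF a] \<mu> by linarith
  fix t assume t: "\<mu> \<le> t"
  have "\<not> cmod (of_real t) \<le> radius a" using t \<mu> radius_nonneg[OF a] by simp
  then show "invertible_op L nrm (shifted a (of_real t))"
    using spectrum_le_radius[OF a, of "of_real t"] unfolding op_spectrum_mat_op by blast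
qed

lemma radius_cong: "(\<And>i j. i \<in> R \<Longrightarrow> j \<in> R \<Longrightarrow> a i j = b i j) \<Longrightarrow> radius a = radius b"
  unfolding spectral_radius_def using mat_op_cong[of a b] by simp

lemma mat_mult_mono:
  assumes a: "operator_matrix a" and b: "operator_matrix b" and c: "operator_matrix c" and d: "operator_matrix d"
    and ac: "\<And>i j. i \<in> R \<Longrightarrow> j \<in> R \<Longrightarrow> a i j \<le> c i j" and bd: "\<And>i j. i \<in> R \<Longrightarrow> j \<in> R \<Longrightarrow> b i j \<le> d i j"
    and i: "i \<in> R" and j: "j \<in> R"
  shows "mat_mult R a b i j \<le> mat_mult R c d i j"
  unfolding mat_mult_def
  using operator_matrix_nonneg[OF b] operator_matrix_nonneg[OF c] ac bd i j
  by (intro infsum_mono mat_mult_entry_summable a b c d i j mult_mono) auto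

lemma mat_power_mono:
  assumes a: "operator_matrix a" and b: "operator_matrix b"
    and ab: "\<And>i j. i \<in> R \<Longrightarrow> j \<in> R \<Longrightarrow> a i j \<le> b i j"
  shows "i \<in> R \<Longrightarrow> j \<in> R \<Longrightarrow> mat_power R a k i j \<le> mat_power R b k i j"
proof (induction k arbitrary: i j)
  case (Suc k)
  then show ?case
    using mat_mult_mono[OF a mat_op_mat_power(1)[OF a] b mat_op_mat_power(1)[OF b] ab, of k k i j] by simp
qed simp

text \<open>
  \<open>r(a)\<^sup>m = r(a\<^sup>m) \<le> r(b)\<close>: a growth bound \<open>\<mu>\<close> of \<open>b\<close> controls \<open>a\<^sup>m\<^sup>k\<close>, hence \<open>\<mu>\<^sup>1\<^sup>/\<^sup>m\<close> is a growth bound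
  of \<open>a\<close>; the fewer than \<open>m\<close> remaining factors cost a constant.
\<close>

lemma radius_le_of_power_le:
  assumes a: "operator_matrix a" and b: "operator_matrix b" and m: "1 \<le> m"
    and le: "\<And>i j. i \<in> R \<Longrightarrow> j \<in> R \<Longrightarrow> mat_power R a m i j \<le> b i j"
  shows "radius a \<le> radius b powr (1 / real m)"
proof -
  have "radius a ^ m \<le> radius b"
  proof (rule dense_ge)
    fix \<mu> assume \<mu>: "radius b < \<mu>"
    then have \<mu>0: "0 < \<mu>" using radius_nonneg[OF b] by linarith
    define \<nu> where "\<nu> = \<mu> powr (1 / real m)"
    have \<nu>0: "0 < \<nu>" using \<mu>0 by (simp add: \<nu>_def)
    have \<nu>m: "\<nu> ^ m = \<mu>" using \<mu>0 m by (simp add: \<nu>_def powr_power)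
    obtain C where C: "C > 0" "\<And>k x. x \<in> L \<Longrightarrow> nrm (mat_op R (mat_power R b k) x) \<le> C * \<mu> ^ k * nrm x"
      using radius_less_imp_growth_bound[OF b \<mu>] unfolding growth_bound_def by blast
    obtain B where B: "B > 0" "\<And>x. x \<in> L \<Longrightarrow> nrm (mat_op R a x) \<le> B * nrm x"
      using mat_op_bounded[OF a] by metis
    note Bi = nrm_funpow_le[OF a less_imp_le[OF B(1)] B(2)]
    note am = mat_op_mat_power(1)[OF a, of m]
    have block: "nrm ((mat_op R a ^^ (m * k)) x) \<le> C * \<mu> ^ k * nrm x" if x: "x \<in> L" for k x
    proof -
      have "nrm ((mat_op R a ^^ (m * k)) x) = nrm (mat_op R (mat_power R (mat_power R a m) k) x)"
        using mat_op_cong[of "mat_power R (mat_power R a m) k" "mat_power R a (m * k)", OF mat_power_mat_power[OF a]]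
        by (simp add: mat_op_mat_power(2)[OF a x])
      also have "\<dots> \<le> C * \<mu> ^ k * nrm x"
        using operator_matrix_mono(2)[OF mat_op_mat_power(1)[OF b]
            operator_matrix_nonneg[OF mat_op_mat_power(1)[OF am]] mat_power_mono[OF am b le] C(2) x] .
      finally show ?thesis .
    qed
    define D where "D = max 1 (B / \<nu>)"
    have D1: "1 \<le> D" by (simp add: D_def)
    have BD: "B ^ i \<le> D ^ m * \<nu> ^ i" if "i < m" for i
    proof -
      have "B ^ i \<le> (D * \<nu>) ^ i"
        using B(1) \<nu>0 by (intro power_mono) (auto simp: D_def max_mult_distrib_right)
      also have "\<dots> = D ^ i * \<nu> ^ i" by (rule power_mult_distrib)
      also have "\<dots> \<le> D ^ m * \<nu> ^ i"
        using D1 \<nu>0 that by (intro mult_right_mono power_increasing) auto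
      finally show ?thesis .
    qed
    have "nrm (mat_op R (mat_power R a k) x) \<le> (C * D ^ m) * \<nu> ^ k * nrm x" if x: "x \<in> L" for k x
    proof -
      define q i where "q = k div m" and "i = k mod m"
      have k: "k = m * q + i" and i: "i < m" using m by (auto simp: q_def i_def)
      have "nrm (mat_op R (mat_power R a k) x) = nrm ((mat_op R a ^^ (m * q)) ((mat_op R a ^^ i) x))"
        by (simp add: mat_op_mat_power(2)[OF a x] k funpow_add)
      also have "\<dots> \<le> C * \<mu> ^ q * nrm ((mat_op R a ^^ i) x)"
        by (rule block[OF funpow_mem[OF a x]])
      also have "\<dots> \<le> C * \<mu> ^ q * (B ^ i * nrm x)"
        using C(1) \<mu>0 by (intro mult_left_mono Bi x) auto
      also have "\<dots> \<le> C * \<mu> ^ q * ((D ^ m * \<nu> ^ i) * nrm x)"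
        using C(1) \<mu>0 by (intro mult_left_mono mult_right_mono BD i nrm_nonneg x) auto
      also have "\<dots> = (C * D ^ m) * \<nu> ^ k * nrm x"
        by (simp add: k power_add power_mult \<nu>m mult_ac)
      finally show ?thesis .
    qed
    then have "growth_bound a \<nu>"
      unfolding growth_bound_def using C(1) D1 by (intro exI[of _ "C * D ^ m"]) auto
    then have "radius a \<le> \<nu>" by (rule radius_le_growth_bound[OF a _ \<nu>0])
    then show "radius a ^ m \<le> \<mu>"
      unfolding \<nu>m[symmetric] using radius_nonneg[OF a] by (intro power_mono)
  qed
  then have "(radius a ^ m) powr (1 / real m) \<le> radius b powr (1 / real m)"
    using radius_nonneg[OF a] by (intro powr_mono2) auto
  moreover have "(radius a ^ m) powr (1 / real m) = radius a"
    using radius_nonneg[OF a] m by (cases "radius a = 0") (auto simp: powr_powr simp flip: powr_realpow)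
  ultimately show ?thesis by simp
qed

lemma radius_mat_power_le:
  assumes a: "operator_matrix a" and m: "1 \<le> m"
  shows "radius (mat_power R a m) \<le> radius a ^ m"
proof (rule tendsto_lowerbound)
  show "((\<lambda>e. (radius a + e) ^ m) \<longlongrightarrow> radius a ^ m) (at_right 0)"
    by (auto intro!: tendsto_eq_intros)
  show "\<forall>\<^sub>F e in at_right 0. radius (mat_power R a m) \<le> (radius a + e) ^ m"
    using eventually_at_right_less[of 0]
  proof eventually_elim
    case (elim e)
    define \<mu> where "\<mu> = radius a + e"
    have \<mu>0: "0 < \<mu>" using radius_nonneg[OF a] elim by (simp add: \<mu>_def)
    obtain C where C: "C > 0" "\<And>k x. x \<in> L \<Longrightarrow> nrm (mat_op R (mat_power R a k) x) \<le> C * \<mu> ^ k * nrm x"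
      using radius_less_imp_growth_bound[OF a, of \<mu>] elim unfolding growth_bound_def \<mu>_def by auto
    have "nrm (mat_op R (mat_power R (mat_power R a m) k) x) \<le> C * (\<mu> ^ m) ^ k * nrm x" if "x \<in> L" for k x
      using C(2)[OF that, of "m * k"]
        mat_op_cong[of "mat_power R (mat_power R a m) k" "mat_power R a (m * k)", OF mat_power_mat_power[OF a]]
      by (simp add: power_mult)
    then have "growth_bound (mat_power R a m) (\<mu> ^ m)"
      unfolding growth_bound_def using C(1) by blast
    then show ?case
      unfolding \<mu>_def[symmetric]
      using \<mu>0 by (intro radius_le_growth_bound mat_op_mat_power(1)[OF a]) auto
  qed
qed simp

end

section \<open>Weighted Hoelder inequality for infinite sums\<close>

text \<open>
  Jensen's inequality for \<open>exp\<close>. Indices of weight 0 are discarded first: they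
  contribute the factor \<open>0\<^sup>0 = 1\<close> if \<open>x q = 0\<close>, where \<open>ln\<close> is meaningless.
\<close>

lemma weighted_arith_geo_mean:
  fixes x \<beta> :: "'a \<Rightarrow> real"
  assumes I: "finite I" and \<beta>: "\<And>q. q \<in> I \<Longrightarrow> 0 \<le> \<beta> q" and sum1: "sum \<beta> I = 1"
    and x: "\<And>q. q \<in> I \<Longrightarrow> 0 \<le> x q"
  shows "(\<Prod>q\<in>I. rpow (x q) (\<beta> q)) \<le> (\<Sum>q\<in>I. \<beta> q * x q)"
proof (cases "\<exists>q\<in>I. \<beta> q \<noteq> 0 \<and> x q = 0")
  case True
  then have "(\<Prod>q\<in>I. rpow (x q) (\<beta> q)) = 0"
    using I by (auto simp: rpow_def)
  then show ?thesis using \<beta> x by (simp add: sum_nonneg)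
next
  case False
  define J where "J = {q \<in> I. \<beta> q \<noteq> 0}"
  have J: "finite J" "J \<subseteq> I" "\<And>q. q \<in> J \<Longrightarrow> 0 < x q" "\<And>q. q \<in> J \<Longrightarrow> 0 < \<beta> q"
    using I False x \<beta> by (auto simp: J_def less_le)
  have sumJ: "sum \<beta> J = 1"
    using sum1 I by (subst sum.mono_neutral_left[of I J]) (auto simp: J_def)
  then have "J \<noteq> {}" by auto
  have "(\<Prod>q\<in>I. rpow (x q) (\<beta> q)) = (\<Prod>q\<in>J. x q powr \<beta> q)"
    using I by (intro prod.mono_neutral_cong_right) (auto simp: J_def rpow_def)
  also have "\<dots> = exp (\<Sum>q\<in>J. \<beta> q * ln (x q))"
    unfolding exp_sum[OF J(1)] using J(3) by (intro prod.cong) (fastforce simp: powr_def)+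
  also have "\<dots> \<le> (\<Sum>q\<in>J. \<beta> q * exp (ln (x q)))"
    using convex_on_sum[OF J(1) \<open>J \<noteq> {}\<close> exp_convex sumJ, of "\<lambda>q. ln (x q)"] J(4) by (simp add: less_imp_le)
  also have "\<dots> = (\<Sum>q\<in>J. \<beta> q * x q)" using J(3) by simp
  also have "\<dots> = (\<Sum>q\<in>I. \<beta> q * x q)"
    using I by (intro sum.mono_neutral_left) (auto simp: J_def)
  finally show ?thesis .
qed

lemma rpow_nonneg: "0 \<le> rpow x t" by (simp add: rpow_def)

lemma rpow_one: "rpow 1 t = 1" by (simp add: rpow_def)

lemma rpow_pos: "0 < x \<Longrightarrow> 0 < rpow x t" by (simp add: rpow_def)

lemma rpow_mult_base: "0 \<le> x \<Longrightarrow> 0 \<le> y \<Longrightarrow> rpow (x * y) t = rpow x t * rpow y t"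
  by (simp add: rpow_def powr_mult)

lemma rpow_antimono_exponent: "0 \<le> x \<Longrightarrow> x \<le> 1 \<Longrightarrow> 0 \<le> s \<Longrightarrow> s \<le> t \<Longrightarrow> rpow x t \<le> rpow x s"
  by (auto simp: rpow_def powr_mono' powr_le1)

lemma rpow_mono_base: "0 \<le> x \<Longrightarrow> x \<le> y \<Longrightarrow> 0 \<le> t \<Longrightarrow> rpow x t \<le> rpow y t"
  by (simp add: rpow_def powr_mono2)

lemma rpow_power: "0 \<le> x \<Longrightarrow> rpow (x ^ k) t = rpow x t ^ k"
  by (induction k) (simp_all add: rpow_mult_base, simp add: rpow_def)

text \<open>
  Since \<open>x\<^sub>q / c\<^sub>q \<le> 1\<close>, lowering the exponents to \<open>\<beta> = \<alpha> / \<Sum>\<alpha>\<close> only increases the product of the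
  normalized factors; then weighted AM-GM applies. This is where \<open>\<Sum>\<alpha> \<ge> 1\<close> is used. The inequality
  is linear in \<open>x\<close> on the right, so it can be summed and it can be read as a domination of matrices.
\<close>

lemma prod_rpow_le_weighted_sum:
  fixes x c \<alpha> :: "'a \<Rightarrow> real"
  assumes I: "finite I" and \<alpha>: "\<And>q. q \<in> I \<Longrightarrow> 0 \<le> \<alpha> q" and s: "1 \<le> sum \<alpha> I"
    and x: "\<And>q. q \<in> I \<Longrightarrow> 0 \<le> x q" and xc: "\<And>q. q \<in> I \<Longrightarrow> x q \<le> c q"
    and c: "\<And>q. q \<in> I \<Longrightarrow> \<alpha> q \<noteq> 0 \<Longrightarrow> 0 < c q"
  shows "(\<Prod>q\<in>I. rpow (x q) (\<alpha> q)) \<le>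
    (\<Prod>q\<in>I. rpow (c q) (\<alpha> q)) * (\<Sum>q\<in>I. \<alpha> q / sum \<alpha> I / c q * x q)"
proof -
  define \<beta> where "\<beta> q = \<alpha> q / sum \<alpha> I" for q
  have \<beta>: "0 \<le> \<beta> q" "\<beta> q \<le> \<alpha> q" if "q \<in> I" for q
    using \<alpha>[OF that] s mult_left_mono[OF s \<alpha>[OF that]] by (auto simp: \<beta>_def divide_le_eq)
  have sum1: "sum \<beta> I = 1" using s by (simp add: \<beta>_def flip: sum_divide_distrib)
  have "(\<Prod>q\<in>I. rpow (x q) (\<alpha> q)) = (\<Prod>q\<in>I. rpow (c q) (\<alpha> q) * rpow (x q / c q) (\<alpha> q))"
  proof (intro prod.cong refl)
    fix q assume q: "q \<in> I"
    show "rpow (x q) (\<alpha> q) = rpow (c q) (\<alpha> q) * rpow (x q / c q) (\<alpha> q)"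
    proof (cases "\<alpha> q = 0")
      case False
      then show ?thesis
        using c[OF q] x[OF q] by (subst rpow_mult_base[symmetric]) auto
    qed (simp add: rpow_def)
  qed
  also have "\<dots> = (\<Prod>q\<in>I. rpow (c q) (\<alpha> q)) * (\<Prod>q\<in>I. rpow (x q / c q) (\<alpha> q))"
    by (rule prod.distrib)
  also have "(\<Prod>q\<in>I. rpow (x q / c q) (\<alpha> q)) \<le> (\<Prod>q\<in>I. rpow (x q / c q) (\<beta> q))"
  proof (intro prod_mono conjI rpow_nonneg)
    fix q assume q: "q \<in> I"
    show "rpow (x q / c q) (\<alpha> q) \<le> rpow (x q / c q) (\<beta> q)"
    proof (cases "\<alpha> q = 0")
      case False
      then show ?thesis
        using c[OF q] x[OF q] xc[OF q] \<beta>[OF q] by (intro rpow_antimono_exponent) auto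
    qed (simp add: \<beta>_def)
  qed
  also have "\<dots> \<le> (\<Sum>q\<in>I. \<beta> q * (x q / c q))"
  proof (rule weighted_arith_geo_mean[OF I \<beta>(1) sum1])
    show "0 \<le> x q / c q" if "q \<in> I" for q
      using x[OF that] xc[OF that] by (auto intro: divide_nonneg_nonneg)
  qed
  also have "\<dots> = (\<Sum>q\<in>I. \<alpha> q / sum \<alpha> I / c q * x q)" by (simp add: \<beta>_def)
  finally show ?thesis by (simp add: mult_left_mono prod_nonneg rpow_nonneg)
qed

text \<open>
  Summation of the previous inequality with \<open>c\<^sub>q = \<Sum>\<^sub>p f\<^sub>q\<^sub>p\<close>; the weighted sum on the right then
  adds up to 1. If some \<open>c\<^sub>q\<close> with \<open>\<alpha>\<^sub>q > 0\<close> vanishes, so does every product.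
\<close>

lemma Hoelder_infsum:
  fixes f :: "'a \<Rightarrow> 'b \<Rightarrow> real"
  assumes I: "finite I" and \<alpha>: "\<And>q. q \<in> I \<Longrightarrow> 0 \<le> \<alpha> q" and s: "1 \<le> sum \<alpha> I"
    and f: "\<And>q p. q \<in> I \<Longrightarrow> p \<in> A \<Longrightarrow> 0 \<le> f q p" and sm: "\<And>q. q \<in> I \<Longrightarrow> f q summable_on A"
  shows "(\<lambda>p. \<Prod>q\<in>I. rpow (f q p) (\<alpha> q)) summable_on A"
    and "(\<Sum>\<^sub>\<infinity>p\<in>A. \<Prod>q\<in>I. rpow (f q p) (\<alpha> q)) \<le> (\<Prod>q\<in>I. rpow (infsum (f q) A) (\<alpha> q))"
proof -
  define c where "c q = infsum (f q) A" for q
  have fc: "f q p \<le> c q" if "q \<in> I" "p \<in> A" for q p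
    unfolding c_def using finite_sum_le_infsum[OF sm, of q "{p}"] f that by auto
  have c0: "0 \<le> c q" if "q \<in> I" for q unfolding c_def using f that by (intro infsum_nonneg) auto
  have "(\<lambda>p. \<Prod>q\<in>I. rpow (f q p) (\<alpha> q)) summable_on A \<and>
    (\<Sum>\<^sub>\<infinity>p\<in>A. \<Prod>q\<in>I. rpow (f q p) (\<alpha> q)) \<le> (\<Prod>q\<in>I. rpow (c q) (\<alpha> q))"
  proof (cases "\<exists>q\<in>I. \<alpha> q \<noteq> 0 \<and> c q = 0")
    case True
    then obtain q where q: "q \<in> I" "\<alpha> q \<noteq> 0" "c q = 0" by blast
    have "(\<Prod>q\<in>I. rpow (f q p) (\<alpha> q)) = 0" if "p \<in> A" for p
    proof -
      have "f q p = 0" using fc[OF q(1) that] f[OF q(1) that] q(3) by simp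
      then show ?thesis using q I by (auto simp: rpow_def intro!: bexI[of _ q])
    qed
    then have "((\<lambda>p. \<Prod>q\<in>I. rpow (f q p) (\<alpha> q)) has_sum 0) A" by (intro has_sum_0)
    then show ?thesis by (auto simp: has_sum_iff prod_nonneg rpow_nonneg)
  next
    case False
    define C where "C = (\<Prod>q\<in>I. rpow (c q) (\<alpha> q))"
    have C0: "0 \<le> C" unfolding C_def by (intro prod_nonneg rpow_nonneg)
    define w where "w q = \<alpha> q / sum \<alpha> I / c q" for q
    have le: "(\<Prod>q\<in>I. rpow (f q p) (\<alpha> q)) \<le> C * (\<Sum>q\<in>I. w q * f q p)" if "p \<in> A" for p
      unfolding C_def w_def
      using False c0 by (intro prod_rpow_le_weighted_sum I \<alpha> s f fc that) (auto simp: less_le)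
    have "((\<lambda>p. \<Sum>q\<in>I. w q * f q p) has_sum (\<Sum>q\<in>I. w q * c q)) A"
      using I sm unfolding c_def
    proof (induction I)
      case (insert q I)
      then show ?case by (auto intro!: has_sum_add has_sum_cmult_right)
    qed simp
    then have hs: "((\<lambda>p. C * (\<Sum>q\<in>I. w q * f q p)) has_sum C * (\<Sum>q\<in>I. w q * c q)) A"
      by (rule has_sum_cmult_right)
    have smm: "(\<lambda>p. \<Prod>q\<in>I. rpow (f q p) (\<alpha> q)) summable_on A"
      by (rule summable_on_comparison_test[OF has_sum_imp_summable[OF hs] le])
         (auto intro: prod_nonneg rpow_nonneg)
    have "(\<Sum>q\<in>I. w q * c q) = (\<Sum>q\<in>I. \<alpha> q / sum \<alpha> I)"
      using False by (intro sum.cong) (auto simp: w_def)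
    also have "\<dots> = 1" using s by (simp flip: sum_divide_distrib)
    finally have "(\<Sum>\<^sub>\<infinity>p\<in>A. C * (\<Sum>q\<in>I. w q * f q p)) = C" using infsumI[OF hs] by simp
    moreover have "(\<Sum>\<^sub>\<infinity>p\<in>A. \<Prod>q\<in>I. rpow (f q p) (\<alpha> q)) \<le> (\<Sum>\<^sub>\<infinity>p\<in>A. C * (\<Sum>q\<in>I. w q * f q p))"
      by (intro infsum_mono smm has_sum_imp_summable[OF hs] le)
    ultimately show ?thesis using smm by (simp add: C_def)
  qed
  then show "(\<lambda>p. \<Prod>q\<in>I. rpow (f q p) (\<alpha> q)) summable_on A"
    and "(\<Sum>\<^sub>\<infinity>p\<in>A. \<Prod>q\<in>I. rpow (f q p) (\<alpha> q)) \<le> (\<Prod>q\<in>I. rpow (infsum (f q) A) (\<alpha> q))"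
    by (auto simp: c_def)
qed

section \<open>Hadamard products of operator matrices\<close>

context normalized_banach_sequence_space
begin

text \<open>
  \<open>\<parallel>K\<^sub>1\<^bsup>(\<alpha>\<^sub>1)\<^esup> \<circ> \<dots> \<circ> K\<^sub>n\<^bsup>(\<alpha>\<^sub>n)\<^esup>\<parallel> \<le> \<parallel>K\<^sub>1\<parallel>\<^bsup>\<alpha>\<^sub>1\<^esup> \<cdots> \<parallel>K\<^sub>n\<parallel>\<^bsup>\<alpha>\<^sub>n\<^esup>\<close>. Entries are at most the norms \<open>c\<^sub>q\<close>, so the
  Hadamard product is at most \<open>C \<Sum>\<^sub>q \<beta>\<^sub>q K\<^sub>q / c\<^sub>q\<close> with \<open>C = \<Prod>\<^sub>q c\<^sub>q\<^bsup>\<alpha>\<^sub>q\<^esup>\<close>, an operator of norm at most \<open>C\<close>.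
\<close>

lemma hadamard_prod_bounded:
  assumes K: "\<And>q. q \<in> {1..n} \<Longrightarrow> operator_matrix (K q)"
    and \<alpha>: "\<And>q. q \<in> {1..n} \<Longrightarrow> 0 \<le> \<alpha> q" and s: "1 \<le> sum \<alpha> {1..n}"
    and c: "\<And>q. q \<in> {1..n} \<Longrightarrow> 0 < c q"
    and Kc: "\<And>q x. q \<in> {1..n} \<Longrightarrow> x \<in> L \<Longrightarrow> nrm (mat_op R (K q) x) \<le> c q * nrm x"
  shows "operator_matrix (hadamard_prod n K \<alpha>)"
    and "x \<in> L \<Longrightarrow> nrm (mat_op R (hadamard_prod n K \<alpha>) x) \<le> (\<Prod>q\<in>{1..n}. rpow (c q) (\<alpha> q)) * nrm x"
proof -
  define C where "C = (\<Prod>q\<in>{1..n}. rpow (c q) (\<alpha> q))"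
  define w where "w q = C * (\<alpha> q / sum \<alpha> {1..n} / c q)" for q
  have C0: "0 \<le> C" unfolding C_def by (intro prod_nonneg rpow_nonneg)
  have w: "0 \<le> w q" if "q \<in> {1..n}" for q
    unfolding w_def using C0 \<alpha>[OF that] c[OF that] s
    by (intro mult_nonneg_nonneg divide_nonneg_nonneg) auto
  have le: "hadamard_prod n K \<alpha> i j \<le> (\<Sum>q\<in>{1..n}. w q * K q i j)" if ij: "i \<in> R" "j \<in> R" for i j
  proof -
    have "hadamard_prod n K \<alpha> i j \<le> C * (\<Sum>q\<in>{1..n}. \<alpha> q / sum \<alpha> {1..n} / c q * K q i j)"
      unfolding hadamard_prod_def C_def
      using operator_matrix_nonneg[OF K ij] entry_le_bound[OF K Kc ij] c
      by (intro prod_rpow_le_weighted_sum \<alpha> s) auto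
    then show ?thesis by (simp add: w_def sum_distrib_left mult.assoc)
  qed
  have H0: "0 \<le> hadamard_prod n K \<alpha> i j" for i j
    unfolding hadamard_prod_def by (intro prod_nonneg rpow_nonneg)
  show "operator_matrix (hadamard_prod n K \<alpha>)"
    by (rule operator_matrix_dominated(1)[OF finite_atLeastAtMost K w H0 le])
  have "(\<Sum>q\<in>{1..n}. w q * c q) = (\<Sum>q\<in>{1..n}. C * (\<alpha> q / sum \<alpha> {1..n}))"
    using c by (intro sum.cong) (auto simp: w_def less_imp_neq[symmetric])
  also have "\<dots> = C" using s by (simp flip: sum_distrib_left sum_divide_distrib)
  finally show "nrm (mat_op R (hadamard_prod n K \<alpha>) x) \<le> (\<Prod>q\<in>{1..n}. rpow (c q) (\<alpha> q)) * nrm x" if "x \<in> L"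
    using operator_matrix_dominated(2)[OF finite_atLeastAtMost K w H0 le Kc that] by (simp add: C_def)
qed

lemma operator_matrix_hadamard_prod:
  assumes K: "\<And>q. q \<in> {1..n} \<Longrightarrow> operator_matrix (K q)"
    and \<alpha>: "\<And>q. q \<in> {1..n} \<Longrightarrow> 0 \<le> \<alpha> q" and s: "1 \<le> sum \<alpha> {1..n}"
  shows "operator_matrix (hadamard_prod n K \<alpha>)"
proof -
  have "\<exists>c>0. \<forall>x\<in>L. nrm (mat_op R (K q) x) \<le> c * nrm x" if "q \<in> {1..n}" for q
    using mat_op_bounded[OF K[OF that]] by metis
  then obtain c where "\<And>q. q \<in> {1..n} \<Longrightarrow> 0 < c q"
      "\<And>q x. q \<in> {1..n} \<Longrightarrow> x \<in> L \<Longrightarrow> nrm (mat_op R (K q) x) \<le> c q * nrm x"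
    by metis
  from hadamard_prod_bounded(1)[OF K \<alpha> s this] show ?thesis .
qed

text \<open>
  The Hoelder inequality applied to each entry of the product.
\<close>

lemma mat_mult_hadamard_prod_le:
  assumes K: "\<And>q. q \<in> {1..n} \<Longrightarrow> operator_matrix (K q)" and K': "\<And>q. q \<in> {1..n} \<Longrightarrow> operator_matrix (K' q)"
    and \<alpha>: "\<And>q. q \<in> {1..n} \<Longrightarrow> 0 \<le> \<alpha> q" and s: "1 \<le> sum \<alpha> {1..n}"
    and i: "i \<in> R" and j: "j \<in> R"
  shows "mat_mult R (hadamard_prod n K \<alpha>) (hadamard_prod n K' \<alpha>) i j
    \<le> hadamard_prod n (\<lambda>q. mat_mult R (K q) (K' q)) \<alpha> i j"
proof -
  have "mat_mult R (hadamard_prod n K \<alpha>) (hadamard_prod n K' \<alpha>) i j =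
      (\<Sum>\<^sub>\<infinity>p\<in>R. \<Prod>q\<in>{1..n}. rpow (K q i p * K' q p j) (\<alpha> q))"
    unfolding mat_mult_def hadamard_prod_def prod.distrib[symmetric]
    using operator_matrix_nonneg[OF K i] operator_matrix_nonneg[OF K' _ j]
    by (intro infsum_cong prod.cong refl rpow_mult_base[symmetric]) auto
  also have "\<dots> \<le> (\<Prod>q\<in>{1..n}. rpow (\<Sum>\<^sub>\<infinity>p\<in>R. K q i p * K' q p j) (\<alpha> q))"
    using operator_matrix_nonneg[OF K i] operator_matrix_nonneg[OF K' _ j]
    by (intro Hoelder_infsum(2) \<alpha> s mat_mult_entry_summable K K' i j mult_nonneg_nonneg) auto
  finally show ?thesis by (simp add: hadamard_prod_def mat_mult_def)
qed

lemma mat_power_hadamard_prod_le: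
  assumes K: "\<And>q. q \<in> {1..n} \<Longrightarrow> operator_matrix (K q)"
    and \<alpha>: "\<And>q. q \<in> {1..n} \<Longrightarrow> 0 \<le> \<alpha> q" and s: "1 \<le> sum \<alpha> {1..n}"
  shows "i \<in> R \<Longrightarrow> j \<in> R \<Longrightarrow>
    mat_power R (hadamard_prod n K \<alpha>) k i j \<le> hadamard_prod n (\<lambda>q. mat_power R (K q) k) \<alpha> i j"
proof (induction k arbitrary: i j)
  case 0
  show ?case by (auto simp: hadamard_prod_def rpow_one intro!: prod_nonneg rpow_nonneg)
next
  case (Suc k)
  note H = operator_matrix_hadamard_prod[OF K \<alpha> s]
  note Hk = operator_matrix_hadamard_prod[OF mat_op_mat_power(1)[OF K] \<alpha> s]
  have "mat_power R (hadamard_prod n K \<alpha>) (Suc k) i j \<le>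
      mat_mult R (hadamard_prod n K \<alpha>) (hadamard_prod n (\<lambda>q. mat_power R (K q) k) \<alpha>) i j"
    using mat_mult_mono[OF H mat_op_mat_power(1)[OF H] H Hk order.refl Suc.IH Suc.prems] by simp
  also have "\<dots> \<le> hadamard_prod n (\<lambda>q. mat_mult R (K q) (mat_power R (K q) k)) \<alpha> i j"
    by (rule mat_mult_hadamard_prod_le[OF K mat_op_mat_power(1)[OF K] \<alpha> s Suc.prems])
  finally show ?case by simp
qed

lemma radius_hadamard_prod_le_power:
  assumes K: "\<And>q. q \<in> {1..n} \<Longrightarrow> operator_matrix (K q)"
    and \<alpha>: "\<And>q. q \<in> {1..n} \<Longrightarrow> 0 \<le> \<alpha> q" and s: "1 \<le> sum \<alpha> {1..n}" and m: "1 \<le> m"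
  shows "radius (hadamard_prod n K \<alpha>) \<le> radius (hadamard_prod n (\<lambda>q. mat_power R (K q) m) \<alpha>) powr (1 / real m)"
  by (rule radius_le_of_power_le[OF operator_matrix_hadamard_prod[OF K \<alpha> s]
        operator_matrix_hadamard_prod[OF mat_op_mat_power(1)[OF K] \<alpha> s] m
        mat_power_hadamard_prod_le[OF K \<alpha> s]])

text \<open>
  If \<open>\<parallel>K\<^sub>q\<^sup>k\<parallel> \<le> C\<^sub>q \<mu>\<^sub>q\<^sup>k\<close>, then the \<open>k\<close>-th power of the Hadamard product, being at most the
  Hadamard product of the \<open>k\<close>-th powers, has norm at most \<open>\<Prod>\<^sub>q (C\<^sub>q \<mu>\<^sub>q\<^sup>k)\<^bsup>\<alpha>\<^sub>q\<^esup>\<close>. So \<open>\<Prod>\<^sub>q \<mu>\<^sub>q\<^bsup>\<alpha>\<^sub>q\<^esup>\<close> is a growth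
  bound, and \<open>\<mu>\<^sub>q\<close> may tend to \<open>r(K\<^sub>q)\<close>.
\<close>

lemma radius_hadamard_prod_le:
  assumes K: "\<And>q. q \<in> {1..n} \<Longrightarrow> operator_matrix (K q)"
    and \<alpha>: "\<And>q. q \<in> {1..n} \<Longrightarrow> 0 \<le> \<alpha> q" and s: "1 \<le> sum \<alpha> {1..n}"
  shows "radius (hadamard_prod n K \<alpha>) \<le> (\<Prod>q\<in>{1..n}. rpow (radius (K q)) (\<alpha> q))"
proof (rule tendsto_lowerbound)
  have "((\<lambda>e. rpow (radius (K q) + e) (\<alpha> q)) \<longlongrightarrow> rpow (radius (K q)) (\<alpha> q)) (at_right 0)"
    if q: "q \<in> {1..n}" for q
  proof (cases "\<alpha> q = 0")
    case False
    have "((\<lambda>e. (radius (K q) + e) powr \<alpha> q) \<longlongrightarrow> (radius (K q) + 0) powr \<alpha> q) (at_right 0)"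
    proof (intro tendsto_powr' tendsto_intros)
      have "\<forall>\<^sub>F e in at_right 0. 0 \<le> radius (K q) + e"
        using eventually_at_right_less[of 0] by eventually_elim (use radius_nonneg[OF K[OF q]] in simp)
      then show "radius (K q) + 0 \<noteq> 0 \<or> 0 < \<alpha> q \<and> (\<forall>\<^sub>F e in at_right 0. 0 \<le> radius (K q) + e)"
        using \<alpha>[OF q] False by simp
    qed
    then show ?thesis using False by (simp add: rpow_def)
  qed (simp add: rpow_def)
  then show "((\<lambda>e. \<Prod>q\<in>{1..n}. rpow (radius (K q) + e) (\<alpha> q)) \<longlongrightarrow> (\<Prod>q\<in>{1..n}. rpow (radius (K q)) (\<alpha> q))) (at_right 0)"
    by (intro tendsto_prod)
  show "\<forall>\<^sub>F e in at_right 0. radius (hadamard_prod n K \<alpha>) \<le> (\<Prod>q\<in>{1..n}. rpow (radius (K q) + e) (\<alpha> q))"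
    using eventually_at_right_less[of 0]
  proof eventually_elim
    case (elim e)
    define \<mu> where "\<mu> q = radius (K q) + e" for q
    have \<mu>0: "0 < \<mu> q" if "q \<in> {1..n}" for q
      using radius_nonneg[OF K[OF that]] elim by (simp add: \<mu>_def)
    have "\<exists>C>0. \<forall>k. \<forall>x\<in>L. nrm (mat_op R (mat_power R (K q) k) x) \<le> C * \<mu> q ^ k * nrm x" if "q \<in> {1..n}" for q
      using radius_less_imp_growth_bound[OF K[OF that], of "\<mu> q"] elim unfolding growth_bound_def \<mu>_def by auto
    then obtain C where C: "\<And>q. q \<in> {1..n} \<Longrightarrow> 0 < C q"
      "\<And>q k x. q \<in> {1..n} \<Longrightarrow> x \<in> L \<Longrightarrow> nrm (mat_op R (mat_power R (K q) k) x) \<le> C q * \<mu> q ^ k * nrm x"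
      by metis
    define \<nu> where "\<nu> = (\<Prod>q\<in>{1..n}. rpow (\<mu> q) (\<alpha> q))"
    define D where "D = (\<Prod>q\<in>{1..n}. rpow (C q) (\<alpha> q))"
    have pos: "0 < \<nu>" "0 < D" unfolding \<nu>_def D_def using \<mu>0 C(1) by (auto intro!: prod_pos rpow_pos)
    note H = operator_matrix_hadamard_prod[OF K \<alpha> s]
    have "nrm (mat_op R (mat_power R (hadamard_prod n K \<alpha>) k) x) \<le> D * \<nu> ^ k * nrm x" if x: "x \<in> L" for k x
    proof -
      have Ck: "0 < C q * \<mu> q ^ k" if "q \<in> {1..n}" for q using C(1)[OF that] \<mu>0[OF that] by simp
      note Kk = mat_op_mat_power(1)[OF K]
      have "nrm (mat_op R (mat_power R (hadamard_prod n K \<alpha>) k) x)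
          \<le> (\<Prod>q\<in>{1..n}. rpow (C q * \<mu> q ^ k) (\<alpha> q)) * nrm x"
        by (rule operator_matrix_mono(2)[OF hadamard_prod_bounded(1)[OF Kk \<alpha> s Ck C(2)]
            operator_matrix_nonneg[OF mat_op_mat_power(1)[OF H]]
            mat_power_hadamard_prod_le[OF K \<alpha> s] hadamard_prod_bounded(2)[OF Kk \<alpha> s Ck C(2)] x])
      also have "(\<Prod>q\<in>{1..n}. rpow (C q * \<mu> q ^ k) (\<alpha> q)) = (\<Prod>q\<in>{1..n}. rpow (C q) (\<alpha> q) * rpow (\<mu> q) (\<alpha> q) ^ k)"
        using C(1) \<mu>0 by (intro prod.cong refl) (simp add: rpow_mult_base rpow_power less_imp_le)
      also have "\<dots> = D * \<nu> ^ k" by (simp add: D_def \<nu>_def prod.distrib prod_power_distrib)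
      finally show ?thesis .
    qed
    then have "growth_bound (hadamard_prod n K \<alpha>) \<nu>"
      unfolding growth_bound_def using pos by blast
    then show ?case
      using radius_le_growth_bound[OF H _ pos(1)] by (simp add: \<nu>_def \<mu>_def)
  qed
qed simp

text \<open>
  \<open>K\<^sub>1\<^bsup>(\<alpha>\<^sub>1)\<^esup> \<circ> \<dots> \<circ> K\<^sub>n\<^bsup>(\<alpha>\<^sub>n)\<^esup> = Y\<^bsup>(s)\<^esup>\<close>, where \<open>Y\<close> has the exponents \<open>\<beta>\<close>, and \<open>Y\<^bsup>(s)\<^esup>\<close> is itself a
  Hadamard product with one factor and exponent \<open>s \<ge> 1\<close>.
\<close>

lemma radius_hadamard_prod_exponent_scaling:
  assumes K: "\<And>q. q \<in> {1..n} \<Longrightarrow> operator_matrix (K q)"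
    and \<beta>: "\<And>q. q \<in> {1..n} \<Longrightarrow> 0 \<le> \<beta> q" and sum1: "1 \<le> sum \<beta> {1..n}" and s: "1 \<le> s"
    and \<alpha>: "\<And>q. q \<in> {1..n} \<Longrightarrow> \<alpha> q = s * \<beta> q"
  shows "radius (hadamard_prod n K \<alpha>) \<le> radius (hadamard_prod n K \<beta>) powr s"
proof -
  define Y where "Y = hadamard_prod n K \<beta>"
  have Y: "operator_matrix Y" unfolding Y_def by (rule operator_matrix_hadamard_prod[OF K \<beta> sum1])
  have "hadamard_prod n K \<alpha> i j = hadamard_prod 1 (\<lambda>_. Y) (\<lambda>_. s) i j" if "i \<in> R" "j \<in> R" for i j
  proof -
    have "hadamard_prod n K \<alpha> i j = (\<Prod>q\<in>{1..n}. rpow (K q i j) (\<beta> q) powr s)"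
      unfolding hadamard_prod_def using s by (intro prod.cong refl) (auto simp: rpow_def \<alpha> powr_powr mult.commute)
    also have "\<dots> = Y i j powr s"
      unfolding Y_def hadamard_prod_def by (intro prod_powr_distrib[symmetric] rpow_nonneg)
    also have "\<dots> = hadamard_prod 1 (\<lambda>_. Y) (\<lambda>_. s) i j"
      using s by (simp add: hadamard_prod_def rpow_def)
    finally show ?thesis .
  qed
  then have "radius (hadamard_prod n K \<alpha>) = radius (hadamard_prod 1 (\<lambda>_. Y) (\<lambda>_. s))" by (rule radius_cong)
  also have "\<dots> \<le> radius Y powr s"
    using radius_hadamard_prod_le[of 1 "\<lambda>_. Y" "\<lambda>_. s"] Y s by (simp add: rpow_def)
  finally show ?thesis by (simp add: Y_def)
qed

end

theorem theorem3p4: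
  fixes R :: "nat set"
    and L :: "(nat \<Rightarrow> complex) set"
    and nrm :: "(nat \<Rightarrow> complex) \<Rightarrow> real"
    and n m l :: nat
    and K :: "nat \<Rightarrow> nat \<Rightarrow> nat \<Rightarrow> real"
    and \<alpha> \<beta> :: "nat \<Rightarrow> real"
    and s :: real
  assumes "normalized_banach_sequence_space R L nrm"
    and "\<And>i. i \<in> {1..n} \<Longrightarrow> nonneg_matrix R (K i)"
    and "\<And>i. i \<in> {1..n} \<Longrightarrow> defines_operator R L (K i)"
    and "\<And>i. i \<in> {1..n} \<Longrightarrow> 0 \<le> \<alpha> i"
    and "s = (\<Sum>i\<in>{1..n}. \<alpha> i)"
    and "s \<ge> 1"
    and "m \<ge> 1" and "l \<ge> 1"
    and "\<And>i. i \<in> {1..n} \<Longrightarrow> \<beta> i = \<alpha> i / s"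
  shows
    "let r = spectral_radius R L nrm;
         P = (\<lambda>q i. mat_power R (K i) q)
     in
       (r (hadamard_prod n K \<alpha>) \<le> r (hadamard_prod n (P m) \<alpha>) powr (1 / real m) \<and>
        r (hadamard_prod n (P m) \<alpha>) powr (1 / real m)
          \<le> r (hadamard_prod n (P (m * l)) \<alpha>) powr (1 / real (m * l)) \<and>
        r (hadamard_prod n (P (m * l)) \<alpha>) powr (1 / real (m * l))
          \<le> r (hadamard_prod n (P (m * l)) \<beta>) powr (s / real (m * l)) \<and>
        r (hadamard_prod n (P (m * l)) \<beta>) powr (s / real (m * l))
          \<le> (\<Prod>i\<in>{1..n}. rpow (r (K i)) (\<alpha> i)))
       \<and>
       (r (hadamard_prod n K \<alpha>) \<le> r (hadamard_prod n (P m) \<alpha>) powr (1 / real m) \<and>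
        r (hadamard_prod n (P m) \<alpha>) powr (1 / real m)
          \<le> r (hadamard_prod n (P m) \<beta>) powr (s / real m) \<and>
        r (hadamard_prod n (P m) \<beta>) powr (s / real m)
          \<le> r (hadamard_prod n (P (m * l)) \<beta>) powr (s / real (m * l)) \<and>
        r (hadamard_prod n (P (m * l)) \<beta>) powr (s / real (m * l))
          \<le> (\<Prod>i\<in>{1..n}. rpow (r (K i)) (\<alpha> i)))"
proof -
  interpret normalized_banach_sequence_space R L nrm by (rule assms(1))
  define r where "r = spectral_radius R L nrm"
  define P where "P = (\<lambda>q i. mat_power R (K i) q)"
  have K: "operator_matrix (K i)" if "i \<in> {1..n}" for i
    using assms(2,3) that by (simp add: operator_matrix_def)
  have P: "operator_matrix (P q i)" if "i \<in> {1..n}" for q i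
    unfolding P_def by (rule mat_op_mat_power(1)[OF K[OF that]])
  have \<alpha>1: "1 \<le> sum \<alpha> {1..n}" using assms by simp
  have \<beta>0: "0 \<le> \<beta> i" if "i \<in> {1..n}" for i using assms that by simp
  have "sum \<beta> {1..n} = (\<Sum>i\<in>{1..n}. \<alpha> i / s)" using assms(9) by (intro sum.cong) auto
  also have "\<dots> = 1" using assms(5,6) by (simp flip: sum_divide_distrib)
  finally have \<beta>1: "1 \<le> sum \<beta> {1..n}" by simp
  have \<alpha>\<beta>: "\<alpha> i = s * \<beta> i" if "i \<in> {1..n}" for i using assms(6,9) that by simp
  have Hr: "0 \<le> r (hadamard_prod n (P q) \<gamma>)"
    if "\<And>i. i \<in> {1..n} \<Longrightarrow> 0 \<le> \<gamma> i" "1 \<le> sum \<gamma> {1..n}" for q \<gamma>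
    unfolding r_def by (rule radius_nonneg[OF operator_matrix_hadamard_prod[OF P that]])
  have first: "r (hadamard_prod n K \<alpha>) \<le> r (hadamard_prod n (P m) \<alpha>) powr (1 / real m)"
    unfolding r_def P_def by (rule radius_hadamard_prod_le_power[OF K assms(4) \<alpha>1 assms(7)])
  have powers: "r (hadamard_prod n (P m) \<gamma>) powr (t / real m) \<le> r (hadamard_prod n (P (m * l)) \<gamma>) powr (t / real (m * l))"
    if \<gamma>: "\<And>i. i \<in> {1..n} \<Longrightarrow> 0 \<le> \<gamma> i" "1 \<le> sum \<gamma> {1..n}" and t: "0 \<le> t" for \<gamma> t
  proof -
    have "r (hadamard_prod n (P m) \<gamma>) \<le> r (hadamard_prod n (\<lambda>i. mat_power R (P m i) l) \<gamma>) powr (1 / real l)"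
      unfolding r_def by (rule radius_hadamard_prod_le_power[OF P \<gamma> assms(8)])
    also have "r (hadamard_prod n (\<lambda>i. mat_power R (P m i) l) \<gamma>) = r (hadamard_prod n (P (m * l)) \<gamma>)"
      unfolding r_def P_def hadamard_prod_def
      by (intro radius_cong prod.cong refl) (simp add: mat_power_mat_power K)
    finally have "r (hadamard_prod n (P m) \<gamma>) powr (t / real m)
        \<le> (r (hadamard_prod n (P (m * l)) \<gamma>) powr (1 / real l)) powr (t / real m)"
      using Hr[OF \<gamma>] t by (intro powr_mono2) auto
    then show ?thesis by (simp add: powr_powr mult.commute)
  qed
  have scaling: "r (hadamard_prod n (P q) \<alpha>) powr (1 / real q) \<le> r (hadamard_prod n (P q) \<beta>) powr (s / real q)" for q
  proof -
    have "r (hadamard_prod n (P q) \<alpha>) \<le> r (hadamard_prod n (P q) \<beta>) powr s"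
      unfolding r_def by (rule radius_hadamard_prod_exponent_scaling[OF P \<beta>0 \<beta>1 assms(6) \<alpha>\<beta>])
    then have "r (hadamard_prod n (P q) \<alpha>) powr (1 / real q) \<le> (r (hadamard_prod n (P q) \<beta>) powr s) powr (1 / real q)"
      using Hr[OF assms(4) \<alpha>1] by (intro powr_mono2) auto
    then show ?thesis by (simp add: powr_powr)
  qed
  have last: "r (hadamard_prod n (P (m * l)) \<beta>) powr (s / real (m * l)) \<le> (\<Prod>i\<in>{1..n}. rpow (r (K i)) (\<alpha> i))"
  proof -
    define q where "q = m * l"
    have q: "1 \<le> q" using assms(7,8) by (simp add: q_def)
    have "r (hadamard_prod n (P q) \<beta>) \<le> (\<Prod>i\<in>{1..n}. rpow (r (P q i)) (\<beta> i))"
      unfolding r_def by (rule radius_hadamard_prod_le[OF P \<beta>0 \<beta>1])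
    also have "\<dots> \<le> (\<Prod>i\<in>{1..n}. rpow (r (K i) ^ q) (\<beta> i))"
      unfolding r_def P_def
      by (intro prod_mono conjI rpow_nonneg rpow_mono_base radius_nonneg mat_op_mat_power(1) radius_mat_power_le K q \<beta>0)
    finally have "r (hadamard_prod n (P q) \<beta>) powr (s / real q)
        \<le> (\<Prod>i\<in>{1..n}. rpow (r (K i) ^ q) (\<beta> i)) powr (s / real q)"
      using Hr[OF \<beta>0 \<beta>1] assms(6) by (intro powr_mono2) auto
    also have "\<dots> = (\<Prod>i\<in>{1..n}. rpow (r (K i) ^ q) (\<beta> i) powr (s / real q))"
      by (intro prod_powr_distrib rpow_nonneg)
    also have "\<dots> = (\<Prod>i\<in>{1..n}. rpow (r (K i)) (\<alpha> i))"
    proof (intro prod.cong refl)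
      fix i assume i: "i \<in> {1..n}"
      have "0 \<le> r (K i)" unfolding r_def by (rule radius_nonneg[OF K[OF i]])
      then show "rpow (r (K i) ^ q) (\<beta> i) powr (s / real q) = rpow (r (K i)) (\<alpha> i)"
        using q assms(6) \<alpha>\<beta>[OF i]
        by (cases "r (K i) = 0") (auto simp: rpow_def powr_powr mult_ac simp flip: powr_realpow)
    qed
    finally show ?thesis by (simp add: q_def)
  qed
  show ?thesis
    unfolding Let_def r_def[symmetric] P_def[symmetric]
    using first powers[OF assms(4) \<alpha>1, of 1] powers[OF \<beta>0 \<beta>1, of s] scaling[of m] scaling[of "m * l"] last assms(6)
    by simp
qed

end
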